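(* Let $M$ be a smooth $3$-manifold with (possibly empty) boundary, and let $(B,\nu,\mu)$ be a flux system on $M$. Assume that there exists a $1$-form $\eta\in\Omega^1(M)$ adapted to $(B,\nu,\mu)$. Then the vector field $u$ on $M$ defined by $$\iota_u\mu=\frac{\nu\wedge\eta}{\eta(B)}$$ is the unique vector field $u$ on $M$ such that $$\iota_u\iota_B\mu=\nu,\qquad \eta(u)=0,$$ and the vector fields $u$ and $\tilde B:=B/\eta(B)$ 1. are linearly independent at $x\in M$ whenever $\nu|_x\neq 0$; 2. satisfy $\nu(\tilde B)=0=\nu(u)$; 3. commute: $[u,\tilde B]=0$; 4. preserve the volume form $\tilde\mu:=\eta(B)\,\mu$, i.e. $\mathcal L_u\tilde\mu=0=\mathcal L_{\tilde B}\tilde\mu$.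
   Context: All objects are smooth. $\iota_X$ denotes the interior product and $\mathcal L_X$ the Lie derivative with respect to $X$. A flux system on $M$ is a triple $(B,\nu,\mu)$ where $B$ is a vector field on $M$, $\nu$ is a closed $1$-form on $M$ and $\mu$ is a volume form on $M$ such that $\nu(B)=0$ and $\mathcal L_B\mu=0$. A $1$-form $\eta\in\Omega^1(M)$ is adapted to the flux system $(B,\nu,\mu)$ if $\eta(B)>0$ everywhere on $M$ and $d\eta\wedge\nu=0$. *)

theory Defs
  imports "HOL-Analysis.Analysis"
begin

text \<open>
  Smooth 3-manifolds with boundary are given by a topology on an arbitrary type and an atlas of
  charts into the closed half-space. A tangent vector at a point is represented by its components
  in all charts around that point, related by the derivatives of the transition maps. A k-form
  evaluates lists of k tangent vectors. Tangent vectors, vector fields and forms are 0 outside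
  their proper domains, so that equality of functions is equality of vector fields and of forms.
\<close>

definition half_space :: "(real^3) set" where
  "half_space = {x. 0 \<le> x $ 1}"

primrec Ck_on :: "nat \<Rightarrow> 'a::euclidean_space set \<Rightarrow> ('a \<Rightarrow> 'b::real_normed_vector) \<Rightarrow> bool" where
  "Ck_on 0 S f \<longleftrightarrow> continuous_on S f"
| "Ck_on (Suc k) S f \<longleftrightarrow>
     (\<forall>x\<in>S. f differentiable (at x)) \<and> (\<forall>v. Ck_on k S (\<lambda>x. frechet_derivative f (at x) v))"

text \<open>On a set that need not be open, smoothness means having local smooth extensions.\<close>

definition smooth_on :: "'a::euclidean_space set \<Rightarrow> ('a \<Rightarrow> 'b::real_normed_vector) \<Rightarrow> bool" where
  "smooth_on S f \<longleftrightarrow>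
     (\<forall>x\<in>S. \<exists>U g. open U \<and> x \<in> U \<and> (\<forall>k. Ck_on k U g) \<and> (\<forall>y\<in>U \<inter> S. g y = f y))"

text \<open>
  Derivatives are taken within the half-space. The derivative at a boundary point is unique and
  equals the derivative of any smooth extension.
\<close>

abbreviation hderiv :: "(real^3 \<Rightarrow> 'b::real_normed_vector) \<Rightarrow> real^3 \<Rightarrow> real^3 \<Rightarrow> 'b" where
  "hderiv f y \<equiv> frechet_derivative f (at y within half_space)"

type_synonym 'a chart = "'a set \<times> ('a \<Rightarrow> real^3)"

record 'a manifold3 =
  mtop :: "'a topology"
  atlas :: "'a chart set"

abbreviation carrier_of :: "'a manifold3 \<Rightarrow> 'a set" where
  "carrier_of M \<equiv> topspace (mtop M)"

abbreviation chart_image :: "'a chart \<Rightarrow> (real^3) set" where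
  "chart_image c \<equiv> snd c ` fst c"

definition chart_inv :: "'a chart \<Rightarrow> real^3 \<Rightarrow> 'a" where
  "chart_inv c = inv_into (fst c) (snd c)"

definition is_chart :: "'a topology \<Rightarrow> 'a chart \<Rightarrow> bool" where
  "is_chart T c \<longleftrightarrow>
     openin T (fst c) \<and> openin (top_of_set half_space) (chart_image c) \<and>
     homeomorphic_map (subtopology T (fst c)) (top_of_set (chart_image c)) (snd c)"

definition transition :: "'a chart \<Rightarrow> 'a chart \<Rightarrow> real^3 \<Rightarrow> real^3" where
  "transition c c' = snd c' \<circ> chart_inv c"

definition smooth_manifold3 :: "'a manifold3 \<Rightarrow> bool" where
  "smooth_manifold3 M \<longleftrightarrow>
     Hausdorff_space (mtop M) \<and> second_countable (mtop M) \<and>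
     (\<forall>c\<in>atlas M. is_chart (mtop M) c) \<and> (\<Union>c\<in>atlas M. fst c) = carrier_of M \<and>
     (\<forall>c\<in>atlas M. \<forall>c'\<in>atlas M. smooth_on (snd c ` (fst c \<inter> fst c')) (transition c c'))"

definition charts_at :: "'a manifold3 \<Rightarrow> 'a \<Rightarrow> 'a chart set" where
  "charts_at M p = {c \<in> atlas M. p \<in> fst c}"

text \<open>
  The constructions that involve derivatives are computed at each point in a chart around it. By
  the usual transformation rules, they do not depend on which chart is chosen.
\<close>

definition chart_at :: "'a manifold3 \<Rightarrow> 'a \<Rightarrow> 'a chart" where
  "chart_at M p = (SOME c. c \<in> charts_at M p)"

type_synonym 'a tvec = "'a chart \<Rightarrow> real^3"

definition tangent_space :: "'a manifold3 \<Rightarrow> 'a \<Rightarrow> 'a tvec set" where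
  "tangent_space M p =
     {v. (\<forall>c\<in>charts_at M p. \<forall>c'\<in>charts_at M p. v c' = hderiv (transition c c') (snd c p) (v c)) \<and>
         (\<forall>c. c \<notin> charts_at M p \<longrightarrow> v c = 0)}"

text \<open>The tangent vector at \<open>p\<close> with components \<open>x\<close> in the chart \<open>c\<close>.\<close>

definition tangent_of :: "'a manifold3 \<Rightarrow> 'a \<Rightarrow> 'a chart \<Rightarrow> real^3 \<Rightarrow> 'a tvec" where
  "tangent_of M p c x =
     (\<lambda>c'. if c' \<in> charts_at M p then hderiv (transition c c') (snd c p) x else 0)"

definition tlin :: "real \<Rightarrow> 'a tvec \<Rightarrow> real \<Rightarrow> 'a tvec \<Rightarrow> 'a tvec" where
  "tlin a v b w = (\<lambda>c. a *\<^sub>R v c + b *\<^sub>R w c)"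

definition lin_indep2 :: "'a tvec \<Rightarrow> 'a tvec \<Rightarrow> bool" where
  "lin_indep2 v w \<longleftrightarrow> (\<forall>a b. tlin a v b w = (\<lambda>_. 0) \<longrightarrow> a = 0 \<and> b = 0)"

type_synonym 'a vfield = "'a \<Rightarrow> 'a tvec"

definition vf_rep :: "'a vfield \<Rightarrow> 'a chart \<Rightarrow> real^3 \<Rightarrow> real^3" where
  "vf_rep X c y = X (chart_inv c y) c"

definition vector_field :: "'a manifold3 \<Rightarrow> 'a vfield \<Rightarrow> bool" where
  "vector_field M X \<longleftrightarrow>
     (\<forall>p. X p \<in> tangent_space M p) \<and> (\<forall>c\<in>atlas M. smooth_on (chart_image c) (vf_rep X c))"

definition vf_zero :: "'a vfield" where
  "vf_zero = (\<lambda>p c. 0)"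

definition vf_scale :: "('a \<Rightarrow> real) \<Rightarrow> 'a vfield \<Rightarrow> 'a vfield" where
  "vf_scale f X = (\<lambda>p c. f p *\<^sub>R X p c)"

definition lie_bracket :: "'a manifold3 \<Rightarrow> 'a vfield \<Rightarrow> 'a vfield \<Rightarrow> 'a vfield" where
  "lie_bracket M X Y p =
     (let c = chart_at M p; y = snd c p in
      tangent_of M p c
        (hderiv (vf_rep Y c) y (vf_rep X c y) - hderiv (vf_rep X c) y (vf_rep Y c y)))"

type_synonym 'a form = "'a \<Rightarrow> 'a tvec list \<Rightarrow> real"

definition form_rep :: "'a manifold3 \<Rightarrow> 'a form \<Rightarrow> 'a chart \<Rightarrow> (real^3) list \<Rightarrow> real^3 \<Rightarrow> real" where
  "form_rep M \<omega> c xs y = \<omega> (chart_inv c y) (map (tangent_of M (chart_inv c y) c) xs)"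

definition tangent_lists :: "'a manifold3 \<Rightarrow> nat \<Rightarrow> 'a \<Rightarrow> 'a tvec list set" where
  "tangent_lists M k p =
     (if p \<in> carrier_of M then {vs. length vs = k \<and> set vs \<subseteq> tangent_space M p} else {})"

definition diff_form :: "'a manifold3 \<Rightarrow> nat \<Rightarrow> 'a form \<Rightarrow> bool" where
  "diff_form M k \<omega> \<longleftrightarrow>
     (\<forall>p vs. vs \<notin> tangent_lists M k p \<longrightarrow> \<omega> p vs = 0) \<and>
     (\<forall>p. \<forall>vs\<in>tangent_lists M k p. \<forall>i<k. \<forall>v\<in>tangent_space M p. \<forall>w\<in>tangent_space M p. \<forall>a b.
        \<omega> p (vs[i := tlin a v b w]) = a * \<omega> p (vs[i := v]) + b * \<omega> p (vs[i := w])) \<and>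
     (\<forall>p. \<forall>vs\<in>tangent_lists M k p. \<forall>i<k. \<forall>j<k. i \<noteq> j \<and> vs ! i = vs ! j \<longrightarrow> \<omega> p vs = 0) \<and>
     (\<forall>c\<in>atlas M. \<forall>xs. length xs = k \<longrightarrow> smooth_on (chart_image c) (form_rep M \<omega> c xs))"

definition volume_form :: "'a manifold3 \<Rightarrow> 'a form \<Rightarrow> bool" where
  "volume_form M \<mu> \<longleftrightarrow> diff_form M 3 \<mu> \<and> (\<forall>p\<in>carrier_of M. \<exists>vs. \<mu> p vs \<noteq> 0)"

definition form_zero :: "'a form" where
  "form_zero = (\<lambda>p vs. 0)"

definition form_scale :: "('a \<Rightarrow> real) \<Rightarrow> 'a form \<Rightarrow> 'a form" where
  "form_scale f \<omega> = (\<lambda>p vs. f p * \<omega> p vs)"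

definition pairing :: "'a form \<Rightarrow> 'a vfield \<Rightarrow> 'a \<Rightarrow> real" where
  "pairing \<alpha> X p = \<alpha> p [X p]"

definition interior_product :: "'a vfield \<Rightarrow> 'a form \<Rightarrow> 'a form" where
  "interior_product X \<omega> p vs = \<omega> p (X p # vs)"

text \<open>
  The wedge product of a k-form and an l-form, normalised so that
  \<open>(\<alpha> \<and> \<beta>)(v,w) = \<alpha>(v) \<beta>(w) - \<alpha>(w) \<beta>(v)\<close> for 1-forms.
\<close>

definition wedge :: "nat \<Rightarrow> nat \<Rightarrow> 'a form \<Rightarrow> 'a form \<Rightarrow> 'a form" where
  "wedge k l \<omega> \<theta> p vs =
     (if length vs = k + l
      then (\<Sum>\<sigma> | \<sigma> permutes {..<k + l}.
              of_int (sign \<sigma>) * \<omega> p (map (\<lambda>i. vs ! \<sigma> i) [0..<k])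
                              * \<theta> p (map (\<lambda>i. vs ! \<sigma> i) [k..<k + l])) / (fact k * fact l)
      else 0)"

text \<open>
  In a chart, \<open>d\<omega>(v\<^sub>0,\<dots>,v\<^sub>k)\<close> is the alternating sum over i of the derivatives in
  direction \<open>v\<^sub>i\<close> of the function obtained by evaluating \<open>\<omega>\<close> on the other vectors, which are
  extended as constant coordinate fields.
\<close>

definition ext_deriv :: "'a manifold3 \<Rightarrow> 'a form \<Rightarrow> 'a form" where
  "ext_deriv M \<omega> p vs =
     (if p \<in> carrier_of M \<and> set vs \<subseteq> tangent_space M p
      then let c = chart_at M p; xs = map (\<lambda>v. v c) vs in
           \<Sum>i<length xs. (-1) ^ i *
             hderiv (form_rep M \<omega> c (take i xs @ drop (Suc i) xs)) (snd c p) (xs ! i)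
      else 0)"

text \<open>
  This is \<open>(L\<^sub>X \<omega>)(Y\<^sub>1,\<dots>,Y\<^sub>k) = X(\<omega>(Y\<^sub>1,\<dots>,Y\<^sub>k)) - \<Sum>\<^sub>i \<omega>(Y\<^sub>1,\<dots>,[X,Y\<^sub>i],\<dots>,Y\<^sub>k)\<close> for constant
  coordinate fields \<open>Y\<^sub>i\<close>, for which \<open>[X,Y\<^sub>i]\<close> is minus the derivative of \<open>X\<close> along \<open>Y\<^sub>i\<close>.
\<close>

definition lie_deriv :: "'a manifold3 \<Rightarrow> 'a vfield \<Rightarrow> 'a form \<Rightarrow> 'a form" where
  "lie_deriv M X \<omega> p vs =
     (if p \<in> carrier_of M \<and> set vs \<subseteq> tangent_space M p
      then let c = chart_at M p; y = snd c p; xs = map (\<lambda>v. v c) vs in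
           hderiv (form_rep M \<omega> c xs) y (vf_rep X c y) +
           (\<Sum>i<length xs. form_rep M \<omega> c (xs[i := hderiv (vf_rep X c) y (xs ! i)]) y)
      else 0)"

definition flux_system :: "'a manifold3 \<Rightarrow> 'a vfield \<Rightarrow> 'a form \<Rightarrow> 'a form \<Rightarrow> bool" where
  "flux_system M B \<nu> \<mu> \<longleftrightarrow>
     vector_field M B \<and>
     diff_form M 1 \<nu> \<and> ext_deriv M \<nu> = form_zero \<and>
     volume_form M \<mu> \<and>
     pairing \<nu> B = (\<lambda>p. 0) \<and>
     lie_deriv M B \<mu> = form_zero"

definition adapted :: "'a manifold3 \<Rightarrow> 'a vfield \<Rightarrow> 'a form \<Rightarrow> 'a form \<Rightarrow> 'a form \<Rightarrow> bool" where
  "adapted M B \<nu> \<mu> \<eta> \<longleftrightarrow>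
     diff_form M 1 \<eta> \<and>
     (\<forall>p\<in>carrier_of M. pairing \<eta> B p > 0) \<and>
     wedge 2 1 (ext_deriv M \<eta>) \<nu> = form_zero"

end

theory Submission
  imports Defs
begin

text \<open>
  Write \<open>h = \<eta>(B)\<close>, \<open>B' = B/h\<close> and \<open>\<mu>' = h \<mu>\<close>. In a chart a 1-form is a covector field and \<open>\<mu>\<close> is a
  function \<open>m \<noteq> 0\<close> times the triple product, so \<open>\<iota>\<^bsub>u\<^esub> \<mu> = (\<nu> \<and> \<eta>)/h\<close> means \<open>u = (\<nu> \<times> \<eta>)/(m h)\<close>.
  This formula is smooth, and as the equation does not depend on the chart, it defines a vector
  field, which is unique. The double cross product formula, with \<open>\<nu>(B) = 0\<close>, shows that the
  same \<open>u\<close> is the only solution of \<open>\<iota>\<^bsub>u\<^esub>\<iota>\<^bsub>B\<^esub> \<mu> = \<nu>\<close> and \<open>\<eta>(u) = 0\<close>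
  (\<open>interior_product_eq_iff\<close>, \<open>contraction_eq_iff\<close>).

  The remaining claims rest on three relations between coordinate expressions, where \<open>m' = h m\<close> is
  the coefficient of \<open>\<mu>'\<close>:
  \<^item> \<open>m' B' = m B\<close>. Its divergence is that of \<open>m B\<close>, which vanishes because \<open>B\<close> preserves \<open>\<mu>\<close>. So \<open>B'\<close>
    preserves \<open>\<mu>'\<close> (\<open>lie_deriv_B'\<close>).
  \<^item> \<open>m' u = \<nu> \<times> \<eta>\<close>. Its divergence is \<open>\<eta> \<cdot> curl \<nu> - \<nu> \<cdot> curl \<eta>\<close>, where the first term vanishes because
    \<open>d\<nu> = 0\<close> and the second because \<open>d\<eta> \<and> \<nu> = 0\<close>. So \<open>u\<close> preserves \<open>\<mu>'\<close> (\<open>lie_deriv_u\<close>).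
  \<^item> \<open>m' (B' \<times> u) = \<nu>\<close>. The curl of the left-hand side is
    \<open>div (m' u) B' - div (m' B') u + m' [u, B']\<close>; as \<open>d\<nu> = 0\<close> and both divergences vanish, so does the
    bracket (\<open>bracket_zero\<close>).

  Each claim about derivatives concerns one point at a time, and the derivatives at that point are
  all computed in the same chart. It is therefore enough to differentiate these relations there,
  using that derivatives within the half-space are unique even at boundary points
  (\<open>hderiv_unique\<close>). Changes of charts enter only in showing that tangent vectors are
  determined by their components in one chart (\<open>hderiv_transition_comp\<close>).
\<close>

section \<open>Calculus of smooth functions\<close>

lemma Ck_on_subset:
  assumes "Ck_on k U f" "V \<subseteq> U"
  shows "Ck_on k V f"
  using assms by (induction k arbitrary: f) (auto intro: continuous_on_subset)

lemma Ck_on_SucI: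
  assumes "\<And>x. x \<in> U \<Longrightarrow> (f has_derivative D x) (at x)"
    and "\<And>v. Ck_on k U (\<lambda>x. frechet_derivative f (at x) v)"
  shows "Ck_on (Suc k) U f"
  using assms by (auto simp: differentiable_def)

lemma Ck_on_SucD:
  assumes "Ck_on (Suc k) U f" "x \<in> U"
  shows "(f has_derivative frechet_derivative f (at x)) (at x)"
  using assms by (simp add: frechet_derivative_works)

lemma Ck_on_cong:
  assumes "open U" "\<And>x. x \<in> U \<Longrightarrow> f x = g x" "Ck_on k U f"
  shows "Ck_on k U g"
  using assms(2,3)
proof (induction k arbitrary: f g)
  case 0
  then show ?case using continuous_on_cong[of U U f g] by simp
next
  case (Suc k)
  have g: "(g has_derivative frechet_derivative f (at x)) (at x)" if "x \<in> U" for x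
    using has_derivative_transform_within_open[OF Ck_on_SucD[OF Suc.prems(2) that] assms(1) that]
      Suc.prems(1) by simp
  show ?case
  proof (rule Ck_on_SucI[OF g])
    fix v
    show "Ck_on k U (\<lambda>x. frechet_derivative g (at x) v)"
    proof (rule Suc.IH)
      show "frechet_derivative f (at x) v = frechet_derivative g (at x) v" if "x \<in> U" for x
        using frechet_derivative_at[OF g[OF that]] by simp
      show "Ck_on k U (\<lambda>x. frechet_derivative f (at x) v)" using Suc.prems(2) by simp
    qed
  qed
qed

text \<open>It is enough to control some family of derivatives: on an open set it is the Frechet one.\<close>

lemma Ck_on_Suc_derivI:
  assumes "open U" "\<And>x. x \<in> U \<Longrightarrow> (f has_derivative D x) (at x)"
    and "\<And>v. Ck_on k U (\<lambda>x. D x v)"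
  shows "Ck_on (Suc k) U f"
proof (rule Ck_on_SucI[OF assms(2)])
  fix v
  show "Ck_on k U (\<lambda>x. frechet_derivative f (at x) v)"
    by (rule Ck_on_cong[OF assms(1) _ assms(3)[of v]]) (use frechet_derivative_at[OF assms(2)] in auto)
qed

lemma Ck_on_SucD_lower: "Ck_on (Suc k) U f \<Longrightarrow> Ck_on k U f"
proof (induction k arbitrary: f)
  case 0
  then show ?case
    by (auto intro!: continuous_at_imp_continuous_on differentiable_imp_continuous_within)
next
  case (Suc k)
  then show ?case by (metis Ck_on.simps(2))
qed

lemma Ck_on_const: "Ck_on k U (\<lambda>x. a)"
  by (induction k arbitrary: a) auto

lemma Ck_on_add:
  assumes "open U" "Ck_on k U f" "Ck_on k U g"
  shows "Ck_on k U (\<lambda>x. f x + g x)"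
  using assms(2,3)
proof (induction k arbitrary: f g)
  case (Suc k)
  show ?case
    by (rule Ck_on_Suc_derivI[OF assms(1) has_derivative_add[OF Ck_on_SucD Ck_on_SucD]])
      (use Suc in auto)
qed (auto intro: continuous_on_add)

text \<open>Products, scalar multiples, inner products and cross products are all bilinear, so the Leibniz rule
  for a bounded bilinear map covers every product that occurs below.\<close>

lemma Ck_on_bilinear:
  fixes f :: "'a::euclidean_space \<Rightarrow> 'b::real_normed_vector"
    and bop :: "'b \<Rightarrow> 'c::real_normed_vector \<Rightarrow> 'd::real_normed_vector"
  assumes "bounded_bilinear bop" "open U" "Ck_on k U f" "Ck_on k U g"
  shows "Ck_on k U (\<lambda>x. bop (f x) (g x))"
  using assms(3,4)
proof (induction k arbitrary: f g)
  case 0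
  then show ?case using bounded_bilinear.continuous_on[OF assms(1)] by auto
next
  case (Suc k)
  show ?case
  proof (rule Ck_on_Suc_derivI[OF assms(2)
        bounded_bilinear.FDERIV[OF assms(1) Ck_on_SucD[OF Suc.prems(1)] Ck_on_SucD[OF Suc.prems(2)]]])
    show "Ck_on k U (\<lambda>x. bop (f x) (frechet_derivative g (at x) v)
                        + bop (frechet_derivative f (at x) v) (g x))" for v
      by (intro Ck_on_add[OF assms(2)] Suc.IH)
        (use Suc.prems Ck_on_SucD_lower in auto)
  qed
qed

text \<open>The derivative of \<open>1/f\<close> is again built from \<open>1/f\<close> and derivatives of \<open>f\<close>, which makes the
  induction on the order of differentiability work.\<close>

lemma Ck_on_inverse:
  fixes f :: "'a::euclidean_space \<Rightarrow> real"
  assumes "open U" "\<And>x. x \<in> U \<Longrightarrow> f x \<noteq> 0" "Ck_on k U f"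
  shows "Ck_on k U (\<lambda>x. inverse (f x))"
  using assms(3)
proof (induction k)
  case 0
  then show ?case using assms(2) by (auto intro: continuous_on_inverse)
next
  case (Suc k)
  show ?case
  proof (rule Ck_on_Suc_derivI[OF assms(1)])
    show "((\<lambda>x. inverse (f x)) has_derivative
        (\<lambda>v. (- 1) * (inverse (f x) * frechet_derivative f (at x) v * inverse (f x)))) (at x)"
      if "x \<in> U" for x
      using Deriv.has_derivative_inverse[OF assms(2)[OF that] Ck_on_SucD[OF Suc.prems that]] by simp
    show "Ck_on k U (\<lambda>x. (- 1) * (inverse (f x) * frechet_derivative f (at x) v * inverse (f x)))" for v
      by (intro Ck_on_bilinear[OF bounded_bilinear_mult assms(1)] Ck_on_const Suc.IH
          Ck_on_SucD_lower[OF Suc.prems])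
        (use Suc.prems in auto)
  qed
qed

lemma smooth_on_cong:
  assumes "smooth_on S f" "\<And>x. x \<in> S \<Longrightarrow> f x = g x"
  shows "smooth_on S g"
  using assms unfolding smooth_on_def by (metis IntD2)

lemma smooth_on_const: "smooth_on S (\<lambda>x. a)"
  unfolding smooth_on_def by (metis Ck_on_const UNIV_I open_UNIV)

text \<open>An operation that preserves the classes of \<open>k\<close> times differentiable functions preserves smoothness
  because the two local extensions can be restricted to the intersection of their domains.\<close>

lemma smooth_on_lift2:
  fixes S :: "'a::euclidean_space set"
  assumes "\<And>k (U :: 'a set) f g. open U \<Longrightarrow> Ck_on k U f \<Longrightarrow> Ck_on k U g \<Longrightarrow> Ck_on k U (\<lambda>x. F (f x) (g x))"
    and "smooth_on S f" "smooth_on S g"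
  shows "smooth_on S (\<lambda>x. F (f x) (g x))"
  unfolding smooth_on_def
proof
  fix x assume "x \<in> S"
  obtain U f' where U: "open U" "x \<in> U" "\<And>k. Ck_on k U f'" "\<And>y. y \<in> U \<inter> S \<Longrightarrow> f' y = f y"
    using assms(2) \<open>x \<in> S\<close> unfolding smooth_on_def by metis
  obtain V g' where V: "open V" "x \<in> V" "\<And>k. Ck_on k V g'" "\<And>y. y \<in> V \<inter> S \<Longrightarrow> g' y = g y"
    using assms(3) \<open>x \<in> S\<close> unfolding smooth_on_def by metis
  have "Ck_on k (U \<inter> V) (\<lambda>x. F (f' x) (g' x))" for k
    by (rule assms(1)) (use U V in \<open>auto intro: Ck_on_subset\<close>)
  then show "\<exists>W h. open W \<and> x \<in> W \<and> (\<forall>k. Ck_on k W h) \<and> (\<forall>y\<in>W \<inter> S. h y = F (f y) (g y))"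
    using U V by (intro exI[of _ "U \<inter> V"] exI[of _ "\<lambda>x. F (f' x) (g' x)"]) auto
qed

lemma smooth_on_add: "smooth_on S f \<Longrightarrow> smooth_on S g \<Longrightarrow> smooth_on S (\<lambda>x. f x + g x)"
  by (rule smooth_on_lift2[where F = "(+)"]) (auto intro: Ck_on_add)

lemma smooth_on_bilinear:
  assumes "bounded_bilinear bop" "smooth_on S f" "smooth_on S g"
  shows "smooth_on S (\<lambda>x. bop (f x) (g x))"
  using assms by (intro smooth_on_lift2[where F = bop]) (auto intro: Ck_on_bilinear)

lemma smooth_on_sum:
  assumes "\<And>i. i \<in> I \<Longrightarrow> smooth_on S (f i)"
  shows "smooth_on S (\<lambda>x. \<Sum>i\<in>I. f i x)"
  using assms
  by (induction I rule: infinite_finite_induct) (auto intro: smooth_on_const smooth_on_add)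

text \<open>A local extension may vanish off \<open>S\<close>, so its domain is first shrunk to where it does not.\<close>

lemma smooth_on_inverse:
  fixes f :: "'a::euclidean_space \<Rightarrow> real"
  assumes "smooth_on S f" "\<And>x. x \<in> S \<Longrightarrow> f x \<noteq> 0"
  shows "smooth_on S (\<lambda>x. inverse (f x))"
  unfolding smooth_on_def
proof
  fix x assume "x \<in> S"
  then obtain U g where U: "open U" "x \<in> U" "\<And>k. Ck_on k U g" "\<And>y. y \<in> U \<inter> S \<Longrightarrow> g y = f y"
    using assms(1) unfolding smooth_on_def by metis
  define V where "V = {y \<in> U. g y \<noteq> 0}"
  have "continuous_on U g" using U(3)[of 0] by simp
  then have "open V" unfolding V_def using continuous_open_preimage[OF _ U(1), of g "- {0}"]
    by (auto simp: vimage_def Int_def)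
  moreover have "x \<in> V" using U \<open>x \<in> S\<close> assms(2) by (auto simp: V_def)
  moreover have "Ck_on k V (\<lambda>x. inverse (g x))" for k
    by (intro Ck_on_inverse \<open>open V\<close> Ck_on_subset[OF U(3)]) (auto simp: V_def)
  ultimately show "\<exists>W h. open W \<and> x \<in> W \<and> (\<forall>k. Ck_on k W h) \<and> (\<forall>y\<in>W \<inter> S. h y = inverse (f y))"
    using U(4) by (intro exI[of _ V] exI[of _ "\<lambda>x. inverse (g x)"]) (auto simp: V_def)
qed

section \<open>Derivatives within the half-space\<close>

lemma at_within_relatively_open:
  assumes "openin (top_of_set H) S" "y \<in> S"
  shows "at y within S = at y within H"
proof -
  obtain T where "open T" "S = H \<inter> T" using assms(1) by (auto simp: openin_open)
  then show ?thesis using at_within_nhd[of y T S H] assms(2) by auto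
qed

lemma smooth_on_imp_hderiv:
  assumes "smooth_on S f" "openin (top_of_set half_space) S" "y \<in> S"
  shows "(f has_derivative hderiv f y) (at y within half_space)"
proof -
  obtain U g where U: "open U" "y \<in> U" "\<And>k. Ck_on k U g" "\<And>z. z \<in> U \<inter> S \<Longrightarrow> g z = f z"
    using assms(1,3) unfolding smooth_on_def by metis
  have o: "openin (top_of_set half_space) (S \<inter> U)"
    using assms(2) U(1) by (auto simp: openin_open)
  have "(g has_derivative frechet_derivative g (at y)) (at y within S \<inter> U)"
    using Ck_on_SucD[OF U(3)[of "Suc 0"] U(2)] by (rule has_derivative_at_withinI)
  then have "(f has_derivative frechet_derivative g (at y)) (at y within S \<inter> U)"
    by (rule has_derivative_transform[rotated 2]) (use U assms in auto)
  then have "f differentiable (at y within half_space)"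
    using at_within_relatively_open[OF o] assms(3) U(2) by (auto simp: differentiable_def)
  then show ?thesis by (simp add: frechet_derivative_works)
qed

text \<open>Positive multiples of the coordinate vectors lead from any point of the half-space into the
  half-space, so the derivative is determined at boundary points as well.\<close>

lemma hderiv_unique:
  assumes "(f has_derivative D) (at y within half_space)" "(f has_derivative D') (at y within half_space)"
    and "y \<in> half_space"
  shows "D = D'"
proof (rule frechet_derivative_unique_within[OF assms(1,2)])
  fix i :: "real^3" and e :: real
  assume i: "i \<in> Basis" and "e > 0"
  obtain j where "i = axis j 1" using i by (auto simp: Basis_vec_def)
  then have "y + (e / 2) *\<^sub>R i \<in> half_space"
    using assms(3) \<open>e > 0\<close> by (auto simp: half_space_def axis_def)
  then show "\<exists>d. 0 < \<bar>d\<bar> \<and> \<bar>d\<bar> < e \<and> y + d *\<^sub>R i \<in> half_space"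
    using \<open>e > 0\<close> by (intro exI[of _ "e / 2"]) auto
qed

lemma hderiv_eq:
  assumes "(f has_derivative D) (at y within half_space)" "y \<in> half_space"
  shows "hderiv f y = D"
  using hderiv_unique[OF _ assms] assms(1)
  by (meson differentiable_def frechet_derivative_works)

lemma has_derivative_half_space_cong:
  assumes "openin (top_of_set half_space) S" "y \<in> S" "\<And>z. z \<in> S \<Longrightarrow> g z = f z"
    and "(f has_derivative D) (at y within half_space)"
  shows "(g has_derivative D) (at y within half_space)"
  using has_derivative_transform[OF assms(2,3)] assms(4)
    at_within_relatively_open[OF assms(1,2)] by simp

section \<open>Linear algebra in three dimensions\<close>

abbreviation e3 :: "3 \<Rightarrow> real^3" where "e3 i \<equiv> axis i 1"

definition trace3 :: "(real^3 \<Rightarrow> real^3) \<Rightarrow> real" where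
  "trace3 A = (\<Sum>i\<in>UNIV. A (e3 i) $ i)"

lemma vec3_expand: "(x::real^3) = x $ 1 *\<^sub>R e3 1 + x $ 2 *\<^sub>R e3 2 + x $ 3 *\<^sub>R e3 3"
  by (simp add: vec_eq_iff forall_3 axis_def)

lemma linear_expand3:
  fixes f :: "real^3 \<Rightarrow> 'b::real_vector"
  assumes "linear f"
  shows "f x = x $ 1 *\<^sub>R f (e3 1) + x $ 2 *\<^sub>R f (e3 2) + x $ 3 *\<^sub>R f (e3 3)"
  by (subst vec3_expand[of x]) (simp add: linear_add[OF assms] linear_scale[OF assms])

lemma inner3: "(x::real^3) \<bullet> y = x $ 1 * y $ 1 + x $ 2 * y $ 2 + x $ 3 * y $ 3"
  by (simp add: inner_vec_def sum_3)

lemma bounded_bilinear_cross3: "bounded_bilinear cross3"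
  using bilinear_cross bilinear_conv_bounded_bilinear by blast

text \<open>This is the uniqueness of the determinant: expansion in the basis leaves only the six terms with
  distinct basis vectors, and these are \<open>\<plusminus> F e\<^sub>1 e\<^sub>2 e\<^sub>3\<close>.\<close>

lemma trilinear_alternating_eq_triple:
  fixes F :: "real^3 \<Rightarrow> real^3 \<Rightarrow> real^3 \<Rightarrow> real"
  assumes lin: "\<And>y z. linear (\<lambda>x. F x y z)" "\<And>x z. linear (\<lambda>y. F x y z)" "\<And>x y. linear (\<lambda>z. F x y z)"
    and alt: "\<And>x z. F x x z = 0" "\<And>x y. F x y y = 0" "\<And>x y. F x y x = 0"
  shows "F x y z = F (e3 1) (e3 2) (e3 3) * (x \<bullet> cross3 y z)"
proof -
  have "F x y z + F y x z = 0" for x y z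
    using alt(1)[of "x + y" z] unfolding linear_add[OF lin(1)] linear_add[OF lin(2)] by (simp add: alt)
  then have s12: "F x y z = - F y x z" for x y z
    by (simp add: eq_neg_iff_add_eq_0)
  have "F x y z + F x z y = 0" for x y z
    using alt(2)[of x "y + z"] unfolding linear_add[OF lin(2)] linear_add[OF lin(3)] by (simp add: alt)
  then have s23: "F x y z = - F x z y" for x y z
    by (simp add: eq_neg_iff_add_eq_0)
  have p: "F (e3 1) (e3 3) (e3 2) = - F (e3 1) (e3 2) (e3 3)"
    "F (e3 2) (e3 1) (e3 3) = - F (e3 1) (e3 2) (e3 3)"
    "F (e3 2) (e3 3) (e3 1) = F (e3 1) (e3 2) (e3 3)"
    "F (e3 3) (e3 1) (e3 2) = F (e3 1) (e3 2) (e3 3)"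
    "F (e3 3) (e3 2) (e3 1) = - F (e3 1) (e3 2) (e3 3)"
    using s12 s23 by (smt (verit))+
  show ?thesis
    \<comment> \<open>The occurrences are the 1, 3 and 9 terms created by expanding the arguments in turn.\<close>
    apply (subst linear_expand3[OF lin(1)])
    apply (subst (1 2 3) linear_expand3[OF lin(2)])
    apply (subst (1 2 3 4 5 6 7 8 9) linear_expand3[OF lin(3)])
    apply (simp add: p alt inner3 cross_components algebra_simps)
    done
qed

text \<open>The derivative of the determinant in direction \<open>A\<close> is the trace. It turns the sum in the Lie
  derivative of a volume form into a divergence.\<close>

lemma trace3_triple:
  assumes "linear A"
  shows "A x \<bullet> cross3 y z + x \<bullet> cross3 (A y) z + x \<bullet> cross3 y (A z) = trace3 A * (x \<bullet> cross3 y z)"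
  unfolding linear_expand3[OF assms, of x] linear_expand3[OF assms, of y] linear_expand3[OF assms, of z]
  by (simp add: trace3_def sum_3 inner3 cross_components algebra_simps)

lemma triple_cancel:
  assumes "\<And>v w. a \<bullet> cross3 v w = b \<bullet> cross3 v w"
  shows "a = b"
  using assms[of "e3 2" "e3 3"] assms[of "e3 3" "e3 1"] assms[of "e3 1" "e3 2"]
  by (simp add: vec_eq_iff forall_3 inner3 cross_components axis_def)

text \<open>Reading \<open>N\<close> and \<open>E\<close> as the derivatives of \<open>\<nu>\<close> and \<open>\<eta>\<close> at a point where they take the
  values \<open>n\<close> and \<open>h\<close>, this is \<open>div (\<nu> \<times> \<eta>) = \<eta> \<cdot> curl \<nu> - \<nu> \<cdot> curl \<eta>\<close>. The two assumptions
  make the two terms on the right vanish.\<close>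

lemma trace3_cross:
  assumes N: "\<And>v w. N v \<bullet> w = N w \<bullet> v"
    and E: "n $ 1 * (E (e3 2) $ 3 - E (e3 3) $ 2) + n $ 2 * (E (e3 3) $ 1 - E (e3 1) $ 3)
            + n $ 3 * (E (e3 1) $ 2 - E (e3 2) $ 1) = 0"
  shows "trace3 (\<lambda>v. cross3 n (E v) + cross3 (N v) h) = 0"
proof -
  have "N (e3 1) $ 2 = N (e3 2) $ 1" "N (e3 1) $ 3 = N (e3 3) $ 1" "N (e3 2) $ 3 = N (e3 3) $ 2"
    using N[of "e3 1" "e3 2"] N[of "e3 1" "e3 3"] N[of "e3 2" "e3 3"]
    by (simp_all add: inner3 axis_def)
  then show ?thesis using E
    by (simp add: trace3_def sum_3 cross_components algebra_simps)
qed

text \<open>With \<open>\<nu> = m (Y \<times> X)\<close> near the point and primes (and \<open>N\<close>) for derivatives at the point, this is the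
  identity \<open>curl (m (Y \<times> X)) = div (m X) Y - div (m Y) X + m [X, Y]\<close>: the curl vanishes because \<open>N\<close> is
  symmetric, and both divergences vanish by assumption.\<close>

lemma bracket_eq_zero:
  fixes X Y :: "real^3"
  assumes m: "m \<noteq> 0" and lX: "linear X'" and lY: "linear Y'" and lM: "linear M'"
    and N: "\<And>v w. N v \<bullet> w = N w \<bullet> v"
    and N_eq: "\<And>v. N v = m *\<^sub>R (cross3 Y (X' v) + cross3 (Y' v) X) + M' v *\<^sub>R cross3 Y X"
    and divX: "M' X + m * trace3 X' = 0" and divY: "M' Y + m * trace3 Y' = 0"
  shows "Y' X - X' Y = 0"
proof -
  have s: "N (e3 1) $ 2 - N (e3 2) $ 1 = 0" "N (e3 3) $ 1 - N (e3 1) $ 3 = 0" "N (e3 2) $ 3 - N (e3 3) $ 2 = 0"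
    using N[of "e3 1" "e3 2"] N[of "e3 1" "e3 3"] N[of "e3 2" "e3 3"]
    by (simp_all add: inner3 axis_def)
  have MX: "M' X = X $ 1 * M' (e3 1) + X $ 2 * M' (e3 2) + X $ 3 * M' (e3 3)"
    and MY: "M' Y = Y $ 1 * M' (e3 1) + Y $ 2 * M' (e3 2) + Y $ 3 * M' (e3 3)"
    using linear_expand3[OF lM, of X] linear_expand3[OF lM, of Y] by simp_all
  have "m * (Y' X - X' Y) $ 1 = N (e3 2) $ 3 - N (e3 3) $ 2 
      + (M' Y + m * trace3 Y') * X $ 1 - (M' X + m * trace3 X') * Y $ 1"
    unfolding MX MY linear_expand3[OF lX, of Y] linear_expand3[OF lY, of X] N_eq
    by (simp add: trace3_def sum_3 cross_components algebra_simps)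
  moreover have "m * (Y' X - X' Y) $ 2 = N (e3 3) $ 1 - N (e3 1) $ 3 
      + (M' Y + m * trace3 Y') * X $ 2 - (M' X + m * trace3 X') * Y $ 2"
    unfolding MX MY linear_expand3[OF lX, of Y] linear_expand3[OF lY, of X] N_eq
    by (simp add: trace3_def sum_3 cross_components algebra_simps)
  moreover have "m * (Y' X - X' Y) $ 3 = N (e3 1) $ 2 - N (e3 2) $ 1 
      + (M' Y + m * trace3 Y') * X $ 3 - (M' X + m * trace3 X') * Y $ 3"
    unfolding MX MY linear_expand3[OF lX, of Y] linear_expand3[OF lY, of X] N_eq
    by (simp add: trace3_def sum_3 cross_components algebra_simps)
  ultimately have "(Y' X - X' Y) $ 1 = 0 \<and> (Y' X - X' Y) $ 2 = 0 \<and> (Y' X - X' Y) $ 3 = 0"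
    unfolding s divX divY using m by auto
  then show ?thesis by (simp add: vec_eq_iff forall_3)
qed

section \<open>Charts and tangent vectors\<close>

locale smooth3 =
  fixes M :: "'a manifold3"
  assumes M: "smooth_manifold3 M"
begin

lemma
  shows atlas_is_chart: "c \<in> atlas M \<Longrightarrow> is_chart (mtop M) c"
    and atlas_cover: "(\<Union>c\<in>atlas M. fst c) = carrier_of M"
    and atlas_smooth: "c \<in> atlas M \<Longrightarrow> c' \<in> atlas M \<Longrightarrow>
      smooth_on (snd c ` (fst c \<inter> fst c')) (transition c c')"
  using M unfolding smooth_manifold3_def by blast+

lemma charts_atD:
  assumes "c \<in> charts_at M p"
  shows "c \<in> atlas M" "p \<in> fst c" "is_chart (mtop M) c" "p \<in> carrier_of M"
proof -
  show c: "c \<in> atlas M" "p \<in> fst c" using assms by (auto simp: charts_at_def)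
  show "is_chart (mtop M) c" using c(1) by (rule atlas_is_chart)
  then show "p \<in> carrier_of M" using c openin_subset unfolding is_chart_def by blast
qed

lemma chart_at_in:
  assumes "p \<in> carrier_of M"
  shows "chart_at M p \<in> charts_at M p"
proof -
  obtain c where "c \<in> charts_at M p" using assms atlas_cover unfolding charts_at_def by blast
  then show ?thesis unfolding chart_at_def by (rule someI)
qed

lemma chart_inv_left:
  assumes "c \<in> atlas M" "p \<in> fst c"
  shows "chart_inv c (snd c p) = p"
proof -
  have c: "is_chart (mtop M) c" using assms(1) by (rule atlas_is_chart)
  then have "inj_on (snd c) (topspace (subtopology (mtop M) (fst c)))"
    unfolding is_chart_def by (blast intro: homeomorphic_imp_injective_map)
  moreover have "topspace (subtopology (mtop M) (fst c)) = fst c"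
    using c openin_subset[of "mtop M" "fst c"] by (auto simp: is_chart_def)
  ultimately show ?thesis using assms(2) by (simp add: chart_inv_def)
qed

lemma chart_inv_in:
  assumes "c \<in> atlas M" "y \<in> chart_image c"
  shows "c \<in> charts_at M (chart_inv c y)" "snd c (chart_inv c y) = y"
  using assms(2) chart_inv_left[OF assms(1)] assms(1) by (auto simp: charts_at_def)

lemma openin_chart_image: "c \<in> atlas M \<Longrightarrow> openin (top_of_set half_space) (chart_image c)"
  using atlas_is_chart unfolding is_chart_def by blast

lemma chart_image_subset: "c \<in> atlas M \<Longrightarrow> chart_image c \<subseteq> half_space"
  using openin_imp_subset[OF openin_chart_image] .

lemma openin_chart_image_Int:
  assumes "c \<in> atlas M" "openin (mtop M) W"
  shows "openin (top_of_set half_space) (snd c ` (fst c \<inter> W))"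
proof -
  have c: "is_chart (mtop M) c" using assms(1) by (rule atlas_is_chart)
  then have "open_map (subtopology (mtop M) (fst c)) (top_of_set (chart_image c)) (snd c)"
    unfolding is_chart_def by (blast intro: homeomorphic_imp_open_map)
  moreover have "openin (subtopology (mtop M) (fst c)) (fst c \<inter> W)"
    using assms(2) by (auto simp: openin_subtopology)
  ultimately have "openin (top_of_set (chart_image c)) (snd c ` (fst c \<inter> W))"
    by (simp add: open_map_def)
  then show ?thesis using openin_chart_image[OF assms(1)] by (rule openin_trans)
qed

lemma transition_has_derivative:
  assumes "c \<in> charts_at M p" "c' \<in> charts_at M p"
  shows "(transition c c' has_derivative hderiv (transition c c') (snd c p)) (at (snd c p) within half_space)"
proof (rule smooth_on_imp_hderiv)
  show "smooth_on (snd c ` (fst c \<inter> fst c')) (transition c c')"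
    using assms by (intro atlas_smooth charts_atD)
  show "openin (top_of_set half_space) (snd c ` (fst c \<inter> fst c'))"
    using openin_chart_image_Int[OF charts_atD(1)[OF assms(1)]] charts_atD(3)[OF assms(2)]
    by (simp add: is_chart_def)
  show "snd c p \<in> snd c ` (fst c \<inter> fst c')" using assms by (auto simp: charts_at_def)
qed

lemma coord_in_half_space: "c \<in> charts_at M p \<Longrightarrow> snd c p \<in> half_space"
  using chart_image_subset charts_atD(1,2) by blast

lemma hderiv_transition_self:
  assumes "c \<in> charts_at M p"
  shows "hderiv (transition c c) (snd c p) = (\<lambda>x. x)"
proof (rule hderiv_eq[OF _ coord_in_half_space[OF assms]])
  show "(transition c c has_derivative (\<lambda>x. x)) (at (snd c p) within half_space)"
    by (rule has_derivative_half_space_cong[OF openin_chart_image _ _ has_derivative_ident])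
      (use assms in \<open>auto simp: transition_def chart_inv_left charts_at_def\<close>)
qed

text \<open>The chain rule is applied within the coordinates of the common domain of the three charts,
  which the first transition map carries into the half-space.\<close>

lemma hderiv_transition_comp:
  assumes "c \<in> charts_at M p" "c1 \<in> charts_at M p" "c2 \<in> charts_at M p"
  shows "hderiv (transition c c2) (snd c p) x =
         hderiv (transition c1 c2) (snd c1 p) (hderiv (transition c c1) (snd c p) x)"
proof -
  define S where "S = snd c ` (fst c \<inter> (fst c1 \<inter> fst c2))"
  note atl = charts_atD(1)[OF assms(1)] charts_atD(1)[OF assms(2)]
  have S: "openin (top_of_set half_space) S" unfolding S_def
    using charts_atD(3)[OF assms(2)] charts_atD(3)[OF assms(3)] charts_atD(1)[OF assms(1)]
    by (intro openin_chart_image_Int) (auto simp: is_chart_def)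
  have p: "snd c p \<in> S" using assms by (auto simp: S_def charts_at_def)
  have tp: "transition c c1 (snd c p) = snd c1 p"
    using assms by (auto simp: transition_def chart_inv_left charts_at_def)
  have sub: "transition c c1 ` S \<subseteq> half_space"
    using chart_image_subset[OF atl(2)] atl by (auto simp: S_def transition_def chart_inv_left)
  have "(transition c1 c2 \<circ> transition c c1 has_derivative
      hderiv (transition c1 c2) (snd c1 p) \<circ> hderiv (transition c c1) (snd c p)) (at (snd c p) within S)"
    using diff_chain_within[of "transition c c1" _ "snd c p" S "transition c1 c2"]
      transition_has_derivative[OF assms(1,2)]
      has_derivative_subset[OF transition_has_derivative[OF assms(2,3)] sub]
    by (simp add: at_within_relatively_open[OF S p] tp)
  then have "(transition c1 c2 \<circ> transition c c1 has_derivative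
      hderiv (transition c1 c2) (snd c1 p) \<circ> hderiv (transition c c1) (snd c p))
      (at (snd c p) within half_space)"
    by (simp add: at_within_relatively_open[OF S p])
  then have "(transition c c2 has_derivative
      hderiv (transition c1 c2) (snd c1 p) \<circ> hderiv (transition c c1) (snd c p))
      (at (snd c p) within half_space)"
    by (rule has_derivative_half_space_cong[OF S p, rotated])
      (use atl in \<open>auto simp: S_def transition_def chart_inv_left\<close>)
  then show ?thesis using hderiv_eq[OF _ coord_in_half_space[OF assms(1)], of "transition c c2"] by simp
qed

text \<open>The chain rule for the transition maps is exactly what is needed for the components given by
  \<open>tangent_of\<close> to be compatible with each other.\<close>

lemma tangent_of_in:
  assumes "c \<in> charts_at M p"
  shows "tangent_of M p c x \<in> tangent_space M p"
proof -
  have "tangent_of M p c x c2 = hderiv (transition c1 c2) (snd c1 p) (tangent_of M p c x c1)"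
    if "c1 \<in> charts_at M p" "c2 \<in> charts_at M p" for c1 c2
    using hderiv_transition_comp[OF assms that, of x] that by (simp only: tangent_of_def if_True)
  moreover have "tangent_of M p c x c' = 0" if "c' \<notin> charts_at M p" for c'
    using that by (simp only: tangent_of_def if_False)
  ultimately show ?thesis unfolding tangent_space_def by blast
qed

lemma tangent_of_self: "c \<in> charts_at M p \<Longrightarrow> tangent_of M p c x c = x"
  by (simp add: tangent_of_def hderiv_transition_self)

lemma tangent_of_coord:
  assumes "c \<in> charts_at M p" "v \<in> tangent_space M p"
  shows "tangent_of M p c (v c) = v"
proof
  fix c'
  have "c' \<in> charts_at M p \<Longrightarrow> v c' = hderiv (transition c c') (snd c p) (v c)"
    and "c' \<notin> charts_at M p \<Longrightarrow> v c' = 0"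
    using assms unfolding tangent_space_def by blast+
  then show "tangent_of M p c (v c) c' = v c'" 
    by (cases "c' \<in> charts_at M p") (simp_all add: tangent_of_def)
qed

lemma tangent_eqI:
  assumes "c \<in> charts_at M p" "v \<in> tangent_space M p" "w \<in> tangent_space M p" "v c = w c"
  shows "v = w"
  using assms tangent_of_coord by metis

lemma tangent_space_outside:
  assumes "p \<notin> carrier_of M"
  shows "tangent_space M p = {\<lambda>_. 0}"
proof -
  have "charts_at M p = {}" using assms charts_atD(4) by blast
  then show ?thesis by (auto simp: tangent_space_def)
qed

lemma tangent_of_tlin:
  assumes "c \<in> charts_at M p"
  shows "tangent_of M p c (a *\<^sub>R x + b *\<^sub>R y) = tlin a (tangent_of M p c x) b (tangent_of M p c y)"
proof
  fix c'
  show "tangent_of M p c (a *\<^sub>R x + b *\<^sub>R y) c' = tlin a (tangent_of M p c x) b (tangent_of M p c y) c'"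
  proof (cases "c' \<in> charts_at M p")
    case True
    have "linear (hderiv (transition c c') (snd c p))"
      using transition_has_derivative[OF assms True] has_derivative_linear by blast
    then show ?thesis by (simp add: tangent_of_def tlin_def linear_add linear_scale)
  qed (simp add: tangent_of_def tlin_def)
qed

lemma tangent_of_zero:
  assumes "c \<in> charts_at M p"
  shows "tangent_of M p c 0 = (\<lambda>_. 0)"
  using tangent_of_tlin[OF assms, of 0 0 0 0] by (simp add: tlin_def)

lemma tlin_in:
  assumes "c \<in> charts_at M p" "v \<in> tangent_space M p" "w \<in> tangent_space M p"
  shows "tlin a v b w \<in> tangent_space M p"
  using tangent_of_in[OF assms(1), of "a *\<^sub>R v c + b *\<^sub>R w c"]
  by (simp add: tangent_of_tlin[OF assms(1)] tangent_of_coord[OF assms(1)] assms(2,3))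

section \<open>Forms in coordinates\<close>

text \<open>At every point of its domain \<open>tangent_of\<close> is a linear isomorphism from the coordinate space to the
  tangent space, so multilinearity over the tangent space becomes ordinary multilinearity there.\<close>

lemma form_linear:
  assumes "diff_form M k \<omega>" "c \<in> charts_at M p" "vs \<in> tangent_lists M k p" "i < k"
  shows "linear (\<lambda>x. \<omega> p (vs[i := tangent_of M p c x]))"
proof -
  have "\<omega> p (vs[i := tangent_of M p c (a *\<^sub>R x + b *\<^sub>R y)])
      = a * \<omega> p (vs[i := tangent_of M p c x]) + b * \<omega> p (vs[i := tangent_of M p c y])" for a b x y
    unfolding tangent_of_tlin[OF assms(2)]
    by (rule assms(1)[unfolded diff_form_def, THEN conjunct2, THEN conjunct1, rule_format,
          OF assms(3,4) tangent_of_in[OF assms(2)] tangent_of_in[OF assms(2)]])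
  note eq = this
  show ?thesis
  proof (rule linearI)
    show "\<omega> p (vs[i := tangent_of M p c (x + y)])
        = \<omega> p (vs[i := tangent_of M p c x]) + \<omega> p (vs[i := tangent_of M p c y])" for x y
      using eq[of 1 x 1 y] by simp
    show "\<omega> p (vs[i := tangent_of M p c (a *\<^sub>R x)]) = a *\<^sub>R \<omega> p (vs[i := tangent_of M p c x])" for a x
      using eq[of a x 0 x] by simp
  qed
qed

lemma form_eq_0_outside:
  assumes "diff_form M k \<omega>" "vs \<notin> tangent_lists M k p"
  shows "\<omega> p vs = 0"
  using assms by (auto simp: diff_form_def)

definition covec :: "'a form \<Rightarrow> 'a chart \<Rightarrow> 'a \<Rightarrow> real^3" where
  "covec \<alpha> c p = (\<chi> i. \<alpha> p [tangent_of M p c (e3 i)])"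

definition vol_density :: "'a form \<Rightarrow> 'a chart \<Rightarrow> 'a \<Rightarrow> real" where
  "vol_density \<mu> c p = \<mu> p (map (tangent_of M p c) [e3 1, e3 2, e3 3])"

text \<open>Together with its analogue for 3-forms below, this reduces all computations to vector algebra: in a
  chart, a 1-form is a covector and a 3-form is a multiple of the triple product.\<close>

lemma one_form_tangent_of:
  assumes "diff_form M 1 \<alpha>" "c \<in> charts_at M p"
  shows "\<alpha> p [tangent_of M p c x] = covec \<alpha> c p \<bullet> x"
proof -
  have "linear (\<lambda>x. \<alpha> p ([\<lambda>_. 0][0 := tangent_of M p c x]))"
    by (rule form_linear[OF assms])
      (use charts_atD(4)[OF assms(2)] tangent_of_in[OF assms(2), of 0]
        in \<open>auto simp: tangent_lists_def tangent_of_zero[OF assms(2)]\<close>)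
  then have "linear (\<lambda>x. \<alpha> p [tangent_of M p c x])" by simp
  from linear_expand3[OF this, of x] show ?thesis by (simp add: inner3 covec_def algebra_simps)
qed

lemma one_form_eq:
  assumes "diff_form M 1 \<alpha>" "c \<in> charts_at M p" "v \<in> tangent_space M p"
  shows "\<alpha> p [v] = covec \<alpha> c p \<bullet> v c"
  using one_form_tangent_of[OF assms(1,2)] tangent_of_coord[OF assms(2,3)] by metis

lemma three_form_tangent_of:
  assumes \<mu>: "diff_form M 3 \<mu>" and c: "c \<in> charts_at M p"
  shows "\<mu> p (map (tangent_of M p c) [x, y, z]) = vol_density \<mu> c p * (x \<bullet> cross3 y z)"
proof -
  let ?T = "tangent_of M p c"
  let ?F = "\<lambda>x y z. \<mu> p [?T x, ?T y, ?T z]"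
  have t: "[?T x, ?T y, ?T z] \<in> tangent_lists M 3 p" for x y z
    using tangent_of_in[OF c] charts_atD(4)[OF c] by (auto simp: tangent_lists_def)
  have alt: "\<mu> p vs = 0" if "vs \<in> tangent_lists M 3 p" "i < 3" "j < 3" "i \<noteq> j" "vs ! i = vs ! j" for vs i j
    by (rule \<mu>[unfolded diff_form_def, THEN conjunct2, THEN conjunct2, THEN conjunct1, rule_format,
          OF that(1-3)]) (use that in simp)
  have "?F x y z = ?F (e3 1) (e3 2) (e3 3) * (x \<bullet> cross3 y z)"
  proof (rule trilinear_alternating_eq_triple)
    show "linear (\<lambda>x. ?F x y z)" for y z
      using form_linear[OF \<mu> c t[of 0 y z], of 0] by simp
    show "linear (\<lambda>y. ?F x y z)" for x z
      using form_linear[OF \<mu> c t[of x 0 z], of 1] by simp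
    show "linear (\<lambda>z. ?F x y z)" for x y
      using form_linear[OF \<mu> c t[of x y 0], of 2] by simp
    show "?F x x z = 0" for x z using alt[OF t, of 0 1] by simp
    show "?F x y y = 0" for x y using alt[OF t, of 1 2] by simp
    show "?F x y x = 0" for x y using alt[OF t, of 0 2] by simp
  qed
  then show ?thesis by (simp add: vol_density_def)
qed

lemma three_form_eq:
  assumes "diff_form M 3 \<mu>" "c \<in> charts_at M p"
    and "v \<in> tangent_space M p" "w \<in> tangent_space M p" "x \<in> tangent_space M p"
  shows "\<mu> p [v, w, x] = vol_density \<mu> c p * (v c \<bullet> cross3 (w c) (x c))"
  using three_form_tangent_of[OF assms(1,2), of "v c" "w c" "x c"] tangent_of_coord[OF assms(2)] assms
  by simp

lemma vol_density_nonzero: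
  assumes "volume_form M \<mu>" "c \<in> charts_at M p"
  shows "vol_density \<mu> c p \<noteq> 0"
proof -
  have \<mu>: "diff_form M 3 \<mu>" using assms by (simp add: volume_form_def)
  obtain vs where vs: "\<mu> p vs \<noteq> 0"
    using assms charts_atD(4)[OF assms(2)] by (auto simp: volume_form_def)
  then have "vs \<in> tangent_lists M 3 p" using form_eq_0_outside[OF \<mu>] by blast
  then obtain a b d where "vs = [a, b, d]" "set vs \<subseteq> tangent_space M p"
    by (auto simp: tangent_lists_def numeral_3_eq_3 length_Suc_conv split: if_splits)
  then show ?thesis using three_form_eq[OF \<mu> assms(2), of a b d] vs by auto
qed

lemma smooth_covec:
  assumes "diff_form M 1 \<alpha>" "c \<in> atlas M"
  shows "smooth_on (chart_image c) (\<lambda>z. covec \<alpha> c (chart_inv c z))"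
proof -
  have "smooth_on (chart_image c) (\<lambda>z. \<Sum>i\<in>UNIV. form_rep M \<alpha> c [e3 i] z *\<^sub>R e3 i)"
    by (intro smooth_on_sum smooth_on_bilinear[OF bounded_bilinear_scaleR] smooth_on_const)
      (use assms in \<open>auto simp: diff_form_def\<close>)
  then show ?thesis
    by (rule smooth_on_cong) (simp add: form_rep_def covec_def sum_3 vec_eq_iff forall_3 axis_def)
qed

lemma smooth_vol_density:
  assumes "diff_form M 3 \<mu>" "c \<in> atlas M"
  shows "smooth_on (chart_image c) (\<lambda>z. vol_density \<mu> c (chart_inv c z))"
proof -
  have "smooth_on (chart_image c) (form_rep M \<mu> c [e3 1, e3 2, e3 3])"
    using assms by (auto simp: diff_form_def)
  then show ?thesis by (simp add: form_rep_def[abs_def] vol_density_def)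
qed

lemma form_rep_wrong_length:
  assumes "diff_form M k \<omega>" "length xs \<noteq> k"
  shows "form_rep M \<omega> c xs = (\<lambda>y. 0)"
  using assms form_eq_0_outside[OF assms(1)] by (auto simp: form_rep_def tangent_lists_def fun_eq_iff)

end

section \<open>Exterior and Lie derivatives in coordinates\<close>

lemma wedge_1_1:
  "wedge 1 1 \<alpha> \<beta> p [v, w] = \<alpha> p [v] * \<beta> p [w] - \<alpha> p [w] * \<beta> p [v]"
proof -
  have s: "{..<1 + 1} = insert 0 {1::nat}" by auto
  have "finite {1::nat}" "0 \<notin> {1::nat}" by auto
  then show ?thesis
    unfolding wedge_def s
    by (simp add: sum_over_permutations_insert permutes_sing sign_swap_id swap_id_eq)
qed

lemma wedge_2_1:
  "wedge 2 1 \<omega> \<beta> p [a, b, c] =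
     ((\<omega> p [a, b] - \<omega> p [b, a]) * \<beta> p [c] + (\<omega> p [b, c] - \<omega> p [c, b]) * \<beta> p [a]
      + (\<omega> p [c, a] - \<omega> p [a, c]) * \<beta> p [b]) / 2"
proof -
  have s: "{..<2 + 1} = insert 0 (insert (Suc 0) {2::nat})" by auto
  have f: "finite {Suc 0, 2}" "0 \<notin> {Suc 0, 2}" "finite {2::nat}" "Suc 0 \<notin> {2}" by auto
  have l: "[0..<2] = [0, 1]" "[2..<2 + 1] = [2]" by (simp_all add: upt_rec)
  show ?thesis
    unfolding wedge_def s l
    unfolding sum_over_permutations_insert[OF f(1,2)] sum_over_permutations_insert[OF f(3,4)] permutes_sing
  by (simp add: permutation_swap_id sign_compose sign_swap_id sign_id transpose_def algebra_simps)
qed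

context smooth3
begin

abbreviation crep :: "'a form \<Rightarrow> 'a chart \<Rightarrow> real^3 \<Rightarrow> real^3" where
  "crep \<alpha> c z \<equiv> covec \<alpha> c (chart_inv c z)"

abbreviation drep :: "'a form \<Rightarrow> 'a chart \<Rightarrow> real^3 \<Rightarrow> real" where
  "drep \<mu> c z \<equiv> vol_density \<mu> c (chart_inv c z)"

lemma coord_in_chart_image: "c \<in> charts_at M p \<Longrightarrow> snd c p \<in> chart_image c"
  using charts_atD(2) by blast

lemma chart_inv_coord: "c \<in> charts_at M p \<Longrightarrow> chart_inv c (snd c p) = p"
  using chart_inv_left charts_atD(1,2) by blast

lemma smooth_imp_hderiv_at:
  assumes "smooth_on (chart_image c) f" "c \<in> charts_at M p"
  shows "(f has_derivative hderiv f (snd c p)) (at (snd c p) within half_space)"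
  using smooth_on_imp_hderiv[OF assms(1) openin_chart_image[OF charts_atD(1)[OF assms(2)]]
      coord_in_chart_image[OF assms(2)]] .

text \<open>The derivative at a point of a chart only sees the values on the image of that chart. The values
  elsewhere are those of an arbitrary choice made by \<open>chart_inv\<close>.\<close>

lemma hderiv_chart_eq:
  assumes c: "c \<in> charts_at M p" and eq: "\<And>z. z \<in> chart_image c \<Longrightarrow> g z = f z"
    and D: "(f has_derivative D) (at (snd c p) within half_space)"
  shows "hderiv g (snd c p) = D"
proof (rule hderiv_eq[OF _ coord_in_half_space[OF c]])
  show "(g has_derivative D) (at (snd c p) within half_space)"
    by (rule has_derivative_half_space_cong[OF openin_chart_image[OF charts_atD(1)[OF c]]
          coord_in_chart_image[OF c] eq D])
qed

lemma covec_has_derivative: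
  assumes "diff_form M 1 \<alpha>" "c \<in> charts_at M p"
  shows "(crep \<alpha> c has_derivative hderiv (crep \<alpha> c) (snd c p)) (at (snd c p) within half_space)"
  using smooth_imp_hderiv_at[OF smooth_covec[OF assms(1) charts_atD(1)[OF assms(2)]] assms(2)] .

lemma vol_density_has_derivative:
  assumes "diff_form M 3 \<mu>" "c \<in> charts_at M p"
  shows "(drep \<mu> c has_derivative hderiv (drep \<mu> c) (snd c p)) (at (snd c p) within half_space)"
  using smooth_imp_hderiv_at[OF smooth_vol_density[OF assms(1) charts_atD(1)[OF assms(2)]] assms(2)] .

lemma vf_has_derivative:
  assumes "vector_field M X" "c \<in> charts_at M p"
  shows "(vf_rep X c has_derivative hderiv (vf_rep X c) (snd c p)) (at (snd c p) within half_space)"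
  using smooth_imp_hderiv_at[OF _ assms(2)] assms(1) charts_atD(1)[OF assms(2)]
  unfolding vector_field_def by blast

lemma vf_rep_coord: "c \<in> charts_at M p \<Longrightarrow> vf_rep X c (snd c p) = X p c"
  by (simp add: vf_rep_def chart_inv_coord)

lemma ext_deriv_one_form:
  assumes \<alpha>: "diff_form M 1 \<alpha>" and p: "p \<in> carrier_of M"
    and vw: "v \<in> tangent_space M p" "w \<in> tangent_space M p" and c: "c = chart_at M p"
  shows "ext_deriv M \<alpha> p [v, w] = hderiv (crep \<alpha> c) (snd c p) (v c) \<bullet> w c
                                - hderiv (crep \<alpha> c) (snd c p) (w c) \<bullet> v c"
proof -
  have ca: "c \<in> charts_at M p" using chart_at_in[OF p] c by simp
  have "hderiv (form_rep M \<alpha> c [x]) (snd c p) = (\<lambda>v. hderiv (crep \<alpha> c) (snd c p) v \<bullet> x)" for x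
  proof (rule hderiv_chart_eq[OF ca])
    show "form_rep M \<alpha> c [x] z = crep \<alpha> c z \<bullet> x" if "z \<in> chart_image c" for z
      using one_form_tangent_of[OF \<alpha> chart_inv_in(1)[OF charts_atD(1)[OF ca] that]]
      by (simp add: form_rep_def)
    show "((\<lambda>z. crep \<alpha> c z \<bullet> x) has_derivative (\<lambda>v. hderiv (crep \<alpha> c) (snd c p) v \<bullet> x))
        (at (snd c p) within half_space)"
      by (intro has_derivative_inner_left covec_has_derivative \<alpha> ca)
  qed
  then show ?thesis using p vw by (simp add: ext_deriv_def c[symmetric] Let_def)
qed

text \<open>The divergence of \<open>X\<close> with respect to \<open>\<mu>\<close>, multiplied by the density of \<open>\<mu>\<close> in the chart.\<close>

definition flux_divergence :: "'a vfield \<Rightarrow> 'a form \<Rightarrow> 'a \<Rightarrow> real" where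
  "flux_divergence X \<mu> p = (let c = chart_at M p; y = snd c p in
     hderiv (drep \<mu> c) y (X p c) + vol_density \<mu> c p * trace3 (hderiv (vf_rep X c) y))"

lemma lie_deriv_three_form:
  assumes \<mu>: "diff_form M 3 \<mu>" and X: "vector_field M X" and p: "p \<in> carrier_of M"
    and v: "v \<in> tangent_space M p" "w \<in> tangent_space M p" "x \<in> tangent_space M p"
    and c: "c = chart_at M p"
  shows "lie_deriv M X \<mu> p [v, w, x] = flux_divergence X \<mu> p * (v c \<bullet> cross3 (w c) (x c))"
proof -
  have ca: "c \<in> charts_at M p" using chart_at_in[OF p] c by simp
  let ?A = "hderiv (vf_rep X c) (snd c p)"
  have A: "linear ?A" using vf_has_derivative[OF X ca] has_derivative_linear by blast
  have eq: "form_rep M \<mu> c [a, b, d] z = drep \<mu> c z * (a \<bullet> cross3 b d)"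
    if "z \<in> chart_image c" for a b d z
    using three_form_tangent_of[OF \<mu> chart_inv_in(1)[OF charts_atD(1)[OF ca] that]]
    by (simp add: form_rep_def)
  have "hderiv (form_rep M \<mu> c [a, b, d]) (snd c p)
      = (\<lambda>v. hderiv (drep \<mu> c) (snd c p) v * (a \<bullet> cross3 b d))" for a b d
    by (rule hderiv_chart_eq[OF ca eq has_derivative_mult_left[OF vol_density_has_derivative[OF \<mu> ca]]])
  moreover have "form_rep M \<mu> c [a, b, d] (snd c p) = vol_density \<mu> c p * (a \<bullet> cross3 b d)" for a b d
    using eq[OF coord_in_chart_image[OF ca]] chart_inv_coord[OF ca] by simp
  ultimately have "lie_deriv M X \<mu> p [v, w, x]
      = hderiv (drep \<mu> c) (snd c p) (X p c) * (v c \<bullet> cross3 (w c) (x c))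
        + vol_density \<mu> c p * (?A (v c) \<bullet> cross3 (w c) (x c) + v c \<bullet> cross3 (?A (w c)) (x c)
                           + v c \<bullet> cross3 (w c) (?A (x c)))"
    using p v by (simp add: lie_deriv_def c[symmetric] Let_def vf_rep_coord[OF ca] numeral_3_eq_3 distrib_left)
  also have "\<dots> = flux_divergence X \<mu> p * (v c \<bullet> cross3 (w c) (x c))"
    unfolding trace3_triple[OF A] by (simp add: flux_divergence_def c[symmetric] Let_def distrib_right)
  finally show ?thesis .
qed

text \<open>A field preserves a volume form exactly when its divergence vanishes. Lists of the wrong length give
  zero on both sides, and for the others the triple product factors out.\<close>

lemma lie_deriv_volume_eq_zero_iff:
  assumes \<mu>: "diff_form M 3 \<mu>" and X: "vector_field M X"
  shows "lie_deriv M X \<mu> = form_zero \<longleftrightarrow> (\<forall>p\<in>carrier_of M. flux_divergence X \<mu> p = 0)"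
proof
  assume L: "lie_deriv M X \<mu> = form_zero"
  show "\<forall>p\<in>carrier_of M. flux_divergence X \<mu> p = 0"
  proof
    fix p assume p: "p \<in> carrier_of M"
    let ?c = "chart_at M p"
    let ?T = "tangent_of M p ?c"
    note ca = chart_at_in[OF p]
    have "flux_divergence X \<mu> p * (e3 1 \<bullet> cross3 (e3 2) (e3 3)) = 0"
      using lie_deriv_three_form[OF \<mu> X p tangent_of_in[OF ca] tangent_of_in[OF ca] tangent_of_in[OF ca] refl]
      unfolding L form_zero_def tangent_of_self[OF ca] by metis
    then show "flux_divergence X \<mu> p = 0" by (simp add: cross_basis)
  qed
next
  assume *: "\<forall>p\<in>carrier_of M. flux_divergence X \<mu> p = 0"
  have "lie_deriv M X \<mu> p vs = 0" for p vs
  proof (cases "p \<in> carrier_of M \<and> set vs \<subseteq> tangent_space M p")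
    case True
    show ?thesis
    proof (cases "length vs = 3")
      case len: True
      then obtain a b d where "vs = [a, b, d]"
        by (auto simp: numeral_3_eq_3 length_Suc_conv)
      then show ?thesis using True * lie_deriv_three_form[OF \<mu> X _ _ _ _ refl] by simp
    next
      case False
      then show ?thesis using True
          hderiv_eq[OF has_derivative_const coord_in_half_space[OF chart_at_in], of p "0::real"]
        by (simp add: lie_deriv_def Let_def form_rep_wrong_length[OF \<mu>])
    qed
  next
    case False
    then show ?thesis by (simp only: lie_deriv_def if_False)
  qed
  then show "lie_deriv M X \<mu> = form_zero" by (auto simp: form_zero_def fun_eq_iff)
qed

end

section \<open>The vector field of an adapted form\<close>

text \<open>The product rule for the divergence, with \<open>L\<close> the derivative of the scalar factor.\<close>

lemma trace3_scaled:
  assumes "linear L"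
  shows "trace3 (\<lambda>v. m *\<^sub>R A v + L v *\<^sub>R x) = L x + m * trace3 A"
  using linear_expand3[OF assms, of x] by (simp add: trace3_def sum_3 algebra_simps)

locale adapted_flux = smooth3 M for M :: "'a manifold3" +
  fixes B :: "'a vfield" and \<nu> \<mu> \<eta> :: "'a form"
  assumes flux: "flux_system M B \<nu> \<mu>"
    and adapted: "adapted M B \<nu> \<mu> \<eta>"
begin

lemma B_vf: "vector_field M B" and \<nu>_form: "diff_form M 1 \<nu>" and \<eta>_form: "diff_form M 1 \<eta>"
  and \<mu>_form: "diff_form M 3 \<mu>" and \<mu>_volume: "volume_form M \<mu>"
  and \<nu>_closed: "ext_deriv M \<nu> = form_zero" and \<nu>_B: "pairing \<nu> B = (\<lambda>p. 0)"
  and B_\<mu>: "lie_deriv M B \<mu> = form_zero"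
  and d\<eta>_\<nu>: "wedge 2 1 (ext_deriv M \<eta>) \<nu> = form_zero"
  using flux adapted by (simp_all add: flux_system_def adapted_def volume_form_def)

lemma vf_in: "vector_field M X \<Longrightarrow> X p \<in> tangent_space M p"
  by (simp add: vector_field_def)

abbreviation h :: "'a \<Rightarrow> real" where "h \<equiv> pairing \<eta> B"

lemma h_pos: "p \<in> carrier_of M \<Longrightarrow> h p > 0"
  using adapted by (simp add: adapted_def)

lemma pairing_coord:
  assumes "diff_form M 1 \<alpha>" "X p \<in> tangent_space M p" "c \<in> charts_at M p"
  shows "pairing \<alpha> X p = covec \<alpha> c p \<bullet> X p c"
  using one_form_eq[OF assms(1,3,2)] by (simp add: pairing_def)

lemma pairing_outside:
  assumes "diff_form M 1 \<alpha>" "p \<notin> carrier_of M"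
  shows "pairing \<alpha> X p = 0"
  using form_eq_0_outside[OF assms(1), of "[X p]" p] assms(2) by (simp add: pairing_def tangent_lists_def)

lemma h_coord: "c \<in> charts_at M p \<Longrightarrow> h p = covec \<eta> c p \<bullet> B p c"
  by (rule pairing_coord[OF \<eta>_form vf_in[OF B_vf]])

text \<open>Since \<open>\<mu>(u, v, w)\<close> is the density of \<open>\<mu>\<close> times \<open>u \<cdot> (v \<times> w)\<close> and
  \<open>(\<nu> \<and> \<eta>)(v, w) = (\<nu> \<times> \<eta>) \<cdot> (v \<times> w)\<close>, the equation that defines \<open>u\<close> can be solved in a chart.\<close>

definition ucoord :: "'a chart \<Rightarrow> 'a \<Rightarrow> real^3" where
  "ucoord c p = inverse (vol_density \<mu> c p * h p) *\<^sub>R cross3 (covec \<nu> c p) (covec \<eta> c p)"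

text \<open>The left-hand side does not mention the chart. Hence the formula for the components of \<open>u\<close> in one
  chart transforms correctly to every other chart, and \<open>u\<close> is unique.\<close>

lemma interior_eq_iff_ucoord:
  assumes c: "c \<in> charts_at M p" and v: "v \<in> tangent_space M p"
  shows "(\<forall>x\<in>tangent_space M p. \<forall>y\<in>tangent_space M p.
           \<mu> p [v, x, y] = 1 / h p * (\<nu> p [x] * \<eta> p [y] - \<nu> p [y] * \<eta> p [x])) \<longleftrightarrow> v c = ucoord c p"
    (is "?L \<longleftrightarrow> ?R")
proof -
  let ?n = "covec \<nu> c p" and ?e = "covec \<eta> c p" and ?d = "vol_density \<mu> c p"
  have d: "?d \<noteq> 0" using vol_density_nonzero[OF \<mu>_volume c] .
  have h: "h p \<noteq> 0" using h_pos charts_atD(4)[OF c] by force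
  have eq: "(\<mu> p [v, x, y] = 1 / h p * (\<nu> p [x] * \<eta> p [y] - \<nu> p [y] * \<eta> p [x]))
      \<longleftrightarrow> (?d * h p) *\<^sub>R v c \<bullet> cross3 (x c) (y c) = cross3 ?n ?e \<bullet> cross3 (x c) (y c)"
    if "x \<in> tangent_space M p" "y \<in> tangent_space M p" for x y
  proof -
    have "(?n \<bullet> x c) * (?e \<bullet> y c) - (?n \<bullet> y c) * (?e \<bullet> x c) = cross3 ?n ?e \<bullet> cross3 (x c) (y c)"
      by (simp add: inner3 cross_components algebra_simps)
    then show ?thesis using h
      by (simp add: three_form_eq[OF \<mu>_form c v that] one_form_eq[OF \<nu>_form c] one_form_eq[OF \<eta>_form c]
          that field_simps)
  qed
  show ?thesis
  proof
    assume ?L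
    have "(?d * h p) *\<^sub>R v c = cross3 ?n ?e"
    proof (rule triple_cancel)
      fix x y
      show "(?d * h p) *\<^sub>R v c \<bullet> cross3 x y = cross3 ?n ?e \<bullet> cross3 x y"
        using \<open>?L\<close> eq[OF tangent_of_in[OF c] tangent_of_in[OF c], of x y] tangent_of_in[OF c]
        by (simp add: tangent_of_self[OF c])
    qed
    then show ?R using d h unfolding ucoord_def by (metis mult_eq_0_iff real_vector.scale_one
          left_inverse scaleR_scaleR)
  next
    assume ?R
    then have "(?d * h p) *\<^sub>R v c = cross3 ?n ?e" using d h
      by (simp add: ucoord_def del: inverse_mult_distrib)
    then show ?L using eq by simp
  qed
qed

definition u :: "'a vfield" where
  "u p = (if p \<in> carrier_of M then tangent_of M p (chart_at M p) (ucoord (chart_at M p) p) else (\<lambda>_. 0))"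

lemma u_in: "u p \<in> tangent_space M p"
  by (simp add: u_def tangent_of_in chart_at_in tangent_space_outside)

lemma u_coord:
  assumes c: "c \<in> charts_at M p"
  shows "u p c = ucoord c p"
proof -
  have p: "p \<in> carrier_of M" using charts_atD(4)[OF c] .
  have "u p (chart_at M p) = ucoord (chart_at M p) p"
    using p tangent_of_self[OF chart_at_in[OF p]] by (simp add: u_def)
  then show ?thesis
    using interior_eq_iff_ucoord[OF chart_at_in[OF p] u_in] interior_eq_iff_ucoord[OF c u_in] by simp
qed

lemma smooth_h:
  assumes "c \<in> atlas M"
  shows "smooth_on (chart_image c) (\<lambda>z. h (chart_inv c z))"
proof (rule smooth_on_cong)
  show "smooth_on (chart_image c) (\<lambda>z. crep \<eta> c z \<bullet> vf_rep B c z)"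
    using B_vf assms unfolding vector_field_def
    by (intro smooth_on_bilinear[OF bounded_bilinear_inner] smooth_covec[OF \<eta>_form assms]) blast
  show "crep \<eta> c z \<bullet> vf_rep B c z = h (chart_inv c z)" if "z \<in> chart_image c" for z
    using h_coord[OF chart_inv_in(1)[OF assms that]] by (simp add: vf_rep_def)
qed

lemma u_vf: "vector_field M u"
  unfolding vector_field_def
proof (intro conjI allI ballI)
  fix c assume c: "c \<in> atlas M"
  show "smooth_on (chart_image c) (vf_rep u c)"
  proof (rule smooth_on_cong)
    show "smooth_on (chart_image c) (\<lambda>z. inverse (drep \<mu> c z * h (chart_inv c z)) *\<^sub>R
            cross3 (crep \<nu> c z) (crep \<eta> c z))"
    proof (intro smooth_on_bilinear[OF bounded_bilinear_scaleR] smooth_on_inverse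
        smooth_on_bilinear[OF bounded_bilinear_mult] smooth_on_bilinear[OF bounded_bilinear_cross3]
        smooth_covec smooth_vol_density \<nu>_form \<eta>_form \<mu>_form smooth_h c)
      show "drep \<mu> c z * h (chart_inv c z) \<noteq> 0" if "z \<in> chart_image c" for z
        using vol_density_nonzero[OF \<mu>_volume chart_inv_in(1)[OF c that]]
          h_pos[OF charts_atD(4)[OF chart_inv_in(1)[OF c that]]] by simp
    qed
    show "inverse (drep \<mu> c z * h (chart_inv c z)) *\<^sub>R cross3 (crep \<nu> c z) (crep \<eta> c z) = vf_rep u c z"
      if "z \<in> chart_image c" for z
      using u_coord[OF chart_inv_in(1)[OF c that]] by (simp add: vf_rep_def ucoord_def)
  qed
qed (rule u_in)

lemma interior_product_eq_iff:
  assumes w: "vector_field M w"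
  shows "interior_product w \<mu> = form_scale (\<lambda>p. 1 / h p) (wedge 1 1 \<nu> \<eta>) \<longleftrightarrow> w = u"
proof
  assume L: "interior_product w \<mu> = form_scale (\<lambda>p. 1 / h p) (wedge 1 1 \<nu> \<eta>)"
  show "w = u"
  proof
    fix p
    show "w p = u p"
    proof (cases "p \<in> carrier_of M")
      case True
      note ca = chart_at_in[OF True]
      have "\<mu> p [w p, x, y] = 1 / h p * (\<nu> p [x] * \<eta> p [y] - \<nu> p [y] * \<eta> p [x])" for x y
        using fun_cong[OF fun_cong[OF L, of p], of "[x, y]"]
        unfolding interior_product_def form_scale_def wedge_1_1 .
      then show ?thesis
        using interior_eq_iff_ucoord[OF ca vf_in[OF w]] u_coord[OF ca]
        by (intro tangent_eqI[OF ca vf_in[OF w] u_in]) simp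
    next
      case False
      then show ?thesis using tangent_space_outside[OF False] vf_in[OF w, of p] u_in[of p] by auto
    qed
  qed
next
  assume wu: "w = u"
  have "\<mu> p (u p # vs) = 1 / h p * wedge 1 1 \<nu> \<eta> p vs" for p vs
  proof (cases "length vs = 2")
    case False
    then have "u p # vs \<notin> tangent_lists M 3 p" by (auto simp: tangent_lists_def)
    then show ?thesis using False form_eq_0_outside[OF \<mu>_form] by (simp add: wedge_def)
  next
    case True
    then obtain x y where vs: "vs = [x, y]" by (auto simp: numeral_2_eq_2 length_Suc_conv)
    show ?thesis
    proof (cases "p \<in> carrier_of M \<and> x \<in> tangent_space M p \<and> y \<in> tangent_space M p")
      case True
      then have ca: "chart_at M p \<in> charts_at M p" by (simp add: chart_at_in)
      show ?thesis unfolding vs wedge_1_1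
        using interior_eq_iff_ucoord[OF ca u_in] u_coord[OF ca] True by blast
    next
      case False
      then have "u p # vs \<notin> tangent_lists M 3 p" by (auto simp: tangent_lists_def vs)
      moreover have "[x] \<notin> tangent_lists M 1 p \<or> [y] \<notin> tangent_lists M 1 p"
        using False by (auto simp: tangent_lists_def)
      ultimately show ?thesis
        unfolding vs wedge_1_1
        using form_eq_0_outside[OF \<mu>_form] form_eq_0_outside[OF \<nu>_form] form_eq_0_outside[OF \<eta>_form]
        by auto
    qed
  qed
  then show "interior_product w \<mu> = form_scale (\<lambda>p. 1 / h p) (wedge 1 1 \<nu> \<eta>)"
    by (simp add: wu interior_product_def form_scale_def fun_eq_iff)
qed


lemma \<nu>_B_coord: "c \<in> charts_at M p \<Longrightarrow> covec \<nu> c p \<bullet> B p c = 0"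
  using pairing_coord[OF \<nu>_form, of B p c] vf_in[OF B_vf] \<nu>_B by simp

text \<open>The first condition says that the cross product of \<open>B\<close> with \<open>v\<close> is \<open>\<nu>\<close> up to the density. By the double
  cross product formula, taking the cross product with \<open>\<eta>\<close> and with \<open>B\<close> moves between this condition
  and the formula for \<open>u\<close>, because \<open>\<eta>(v) = 0\<close> and \<open>\<nu>(B) = 0\<close> remove the unwanted terms.\<close>

lemma contraction_eq_iff_ucoord:
  assumes c: "c \<in> charts_at M p" and v: "v \<in> tangent_space M p"
  shows "(\<forall>x\<in>tangent_space M p. \<mu> p [B p, v, x] = \<nu> p [x]) \<and> \<eta> p [v] = 0 \<longleftrightarrow> v c = ucoord c p"
    (is "?L \<longleftrightarrow> ?R")
proof -
  let ?n = "covec \<nu> c p" and ?e = "covec \<eta> c p" and ?d = "vol_density \<mu> c p" and ?b = "B p c"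
  have d: "?d \<noteq> 0" using vol_density_nonzero[OF \<mu>_volume c] .
  have h: "?e \<bullet> ?b \<noteq> 0" using h_pos[OF charts_atD(4)[OF c]] h_coord[OF c] by simp
  have eq: "\<mu> p [B p, v, x] = \<nu> p [x] \<longleftrightarrow> ?d *\<^sub>R cross3 ?b (v c) \<bullet> x c = ?n \<bullet> x c"
    if "x \<in> tangent_space M p" for x
    by (simp add: three_form_eq[OF \<mu>_form c vf_in[OF B_vf] v that] one_form_eq[OF \<nu>_form c that])
      (simp add: inner3 cross_components algebra_simps)
  have "?L \<longleftrightarrow> ?d *\<^sub>R cross3 ?b (v c) = ?n \<and> ?e \<bullet> v c = 0"
  proof -
    have "?d *\<^sub>R cross3 ?b (v c) = ?n" if "\<forall>x\<in>tangent_space M p. \<mu> p [B p, v, x] = \<nu> p [x]"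
    proof (rule vector_eq_rdot[THEN iffD1], rule allI)
      show "?d *\<^sub>R cross3 ?b (v c) \<bullet> x = ?n \<bullet> x" for x
        using eq[OF tangent_of_in[OF c], of x] that tangent_of_in[OF c] unfolding tangent_of_self[OF c] by blast
    qed
    moreover have "\<forall>x\<in>tangent_space M p. \<mu> p [B p, v, x] = \<nu> p [x]" if "?d *\<^sub>R cross3 ?b (v c) = ?n"
      using eq unfolding that by blast
    ultimately show ?thesis unfolding one_form_eq[OF \<eta>_form c v] by blast
  qed
  also have "\<dots> \<longleftrightarrow> ?R"
  proof
    assume L: "?d *\<^sub>R cross3 ?b (v c) = ?n \<and> ?e \<bullet> v c = 0"
    \<comment> \<open>The double cross product formula isolates \<open>v\<close>, with factor \<open>\<eta>(B)\<close>.\<close>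
    have "cross3 (cross3 ?b (v c)) ?e = (?e \<bullet> ?b) *\<^sub>R v c - (?e \<bullet> v c) *\<^sub>R ?b"
      by (simp add: vec_eq_iff forall_3 inner3 cross_components algebra_simps)
    then have "cross3 ?n ?e = (?d * h p) *\<^sub>R v c"
      using L h_coord[OF c] by (metis cross_mult_left diff_zero scaleR_scaleR scaleR_zero_left)
    then show ?R using d h h_coord[OF c] by (simp add: ucoord_def del: inverse_mult_distrib)
  next
    assume R: ?R
    have "cross3 ?b (cross3 ?n ?e) = (?e \<bullet> ?b) *\<^sub>R ?n - (?n \<bullet> ?b) *\<^sub>R ?e"
      by (simp add: vec_eq_iff forall_3 inner3 cross_components algebra_simps)
    then have "cross3 ?b (cross3 ?n ?e) = h p *\<^sub>R ?n" using \<nu>_B_coord[OF c] h_coord[OF c] by simp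
    then have "?d *\<^sub>R cross3 ?b (v c) = (?d * inverse (?d * h p) * h p) *\<^sub>R ?n"
      using R by (simp add: ucoord_def cross_mult_right del: inverse_mult_distrib)
    moreover have "?d * inverse (?d * h p) * h p = 1" using d h h_coord[OF c] by (simp add: field_simps)
    ultimately show "?d *\<^sub>R cross3 ?b (v c) = ?n \<and> ?e \<bullet> v c = 0"
      using R by (simp add: ucoord_def dot_cross_self)
  qed
  finally show ?thesis .
qed

lemma contraction_eq_iff:
  assumes w: "vector_field M w"
  shows "interior_product w (interior_product B \<mu>) = \<nu> \<and> pairing \<eta> w = (\<lambda>p. 0) \<longleftrightarrow> w = u"
proof
  assume L: "interior_product w (interior_product B \<mu>) = \<nu> \<and> pairing \<eta> w = (\<lambda>p. 0)"
  show "w = u"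
  proof
    fix p
    show "w p = u p"
    proof (cases "p \<in> carrier_of M")
      case True
      note ca = chart_at_in[OF True]
      have "\<mu> p [B p, w p, x] = \<nu> p [x]" for x
        using fun_cong[OF fun_cong[OF conjunct1[OF L], of p], of "[x]"]
        unfolding interior_product_def .
      moreover have "\<eta> p [w p] = 0" using fun_cong[OF conjunct2[OF L], of p] by (simp add: pairing_def)
      ultimately show ?thesis
        using contraction_eq_iff_ucoord[OF ca vf_in[OF w]] u_coord[OF ca]
        by (intro tangent_eqI[OF ca vf_in[OF w] u_in]) simp
    next
      case False
      then show ?thesis using tangent_space_outside[OF False] vf_in[OF w, of p] u_in[of p] by auto
    qed
  qed
next
  assume wu: "w = u"
  have *: "(\<forall>x\<in>tangent_space M p. \<mu> p [B p, u p, x] = \<nu> p [x]) \<and> \<eta> p [u p] = 0"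
    if "p \<in> carrier_of M" for p
    using contraction_eq_iff_ucoord[OF chart_at_in[OF that] u_in] u_coord[OF chart_at_in[OF that]] by blast
  have "\<mu> p (B p # u p # vs) = \<nu> p vs" for p vs
  proof (cases "vs \<in> tangent_lists M 1 p")
    case True
    then obtain x where "vs = [x]" "x \<in> tangent_space M p" "p \<in> carrier_of M"
      by (auto simp: tangent_lists_def length_Suc_conv split: if_splits)
    then show ?thesis using * by simp
  next
    case False
    then have "B p # u p # vs \<notin> tangent_lists M 3 p" by (auto simp: tangent_lists_def)
    then show ?thesis using False form_eq_0_outside[OF \<mu>_form] form_eq_0_outside[OF \<nu>_form] by simp
  qed
  moreover have "pairing \<eta> u p = 0" for p
    using * pairing_outside[OF \<eta>_form] by (cases "p \<in> carrier_of M") (auto simp: pairing_def)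
  ultimately show "interior_product w (interior_product B \<mu>) = \<nu> \<and> pairing \<eta> w = (\<lambda>p. 0)"
    by (simp add: wu interior_product_def fun_eq_iff)
qed

section \<open>The rescaled field and volume form\<close>

definition B' :: "'a vfield" where "B' = vf_scale (\<lambda>p. 1 / h p) B"

definition \<mu>' :: "'a form" where "\<mu>' = form_scale h \<mu>"

lemma B'_coord: "B' p c = inverse (h p) *\<^sub>R B p c"
  by (simp add: B'_def vf_scale_def inverse_eq_divide)

lemma vol_density_\<mu>': "vol_density \<mu>' c p = h p * vol_density \<mu> c p"
  by (simp add: vol_density_def \<mu>'_def form_scale_def)

lemma B'_in: "B' p \<in> tangent_space M p"
proof (cases "p \<in> carrier_of M")
  case True
  have "B' p = tlin (1 / h p) (B p) 0 (B p)" by (simp add: B'_def vf_scale_def tlin_def)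
  then show ?thesis using tlin_in[OF chart_at_in[OF True] vf_in[OF B_vf] vf_in[OF B_vf]] by simp
next
  case False
  then show ?thesis using vf_in[OF B_vf, of p] tangent_space_outside[OF False]
    by (simp add: B'_def vf_scale_def)
qed

lemma B'_vf: "vector_field M B'"
  unfolding vector_field_def
proof (intro conjI allI ballI)
  fix c assume c: "c \<in> atlas M"
  have "smooth_on (chart_image c) (\<lambda>z. inverse (h (chart_inv c z)) *\<^sub>R vf_rep B c z)"
  proof (intro smooth_on_bilinear[OF bounded_bilinear_scaleR] smooth_on_inverse smooth_h c)
    show "h (chart_inv c z) \<noteq> 0" if "z \<in> chart_image c" for z
      using h_pos[OF charts_atD(4)[OF chart_inv_in(1)[OF c that]]] by simp
    show "smooth_on (chart_image c) (vf_rep B c)"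
      using B_vf c unfolding vector_field_def by blast
  qed
  then show "smooth_on (chart_image c) (vf_rep B' c)"
    by (rule smooth_on_cong) (simp add: vf_rep_def B'_coord)
qed (rule B'_in)

lemma \<mu>'_form: "diff_form M 3 \<mu>'"
  unfolding diff_form_def
proof (intro conjI)
  show "\<forall>p vs. vs \<notin> tangent_lists M 3 p \<longrightarrow> \<mu>' p vs = 0"
    using form_eq_0_outside[OF \<mu>_form] by (simp add: \<mu>'_def form_scale_def)
  show "\<forall>p. \<forall>vs\<in>tangent_lists M 3 p. \<forall>i<3. \<forall>v\<in>tangent_space M p. \<forall>w\<in>tangent_space M p. \<forall>a b.
      \<mu>' p (vs[i := tlin a v b w]) = a * \<mu>' p (vs[i := v]) + b * \<mu>' p (vs[i := w])"
  proof (intro allI ballI impI)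
    fix p vs v w and i :: nat and a b :: real
    assume "vs \<in> tangent_lists M 3 p" "i < 3" "v \<in> tangent_space M p" "w \<in> tangent_space M p"
    then have "\<mu> p (vs[i := tlin a v b w]) = a * \<mu> p (vs[i := v]) + b * \<mu> p (vs[i := w])"
      by (rule \<mu>_form[unfolded diff_form_def, THEN conjunct2, THEN conjunct1, rule_format])
    then show "\<mu>' p (vs[i := tlin a v b w]) = a * \<mu>' p (vs[i := v]) + b * \<mu>' p (vs[i := w])"
      by (simp add: \<mu>'_def form_scale_def algebra_simps)
  qed
  show "\<forall>p. \<forall>vs\<in>tangent_lists M 3 p. \<forall>i<3. \<forall>j<3. i \<noteq> j \<and> vs ! i = vs ! j \<longrightarrow> \<mu>' p vs = 0"
    using \<mu>_form[unfolded diff_form_def, THEN conjunct2, THEN conjunct2, THEN conjunct1]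
    unfolding \<mu>'_def form_scale_def by (metis mult_zero_right)
  show "\<forall>c\<in>atlas M. \<forall>xs. length xs = 3 \<longrightarrow> smooth_on (chart_image c) (form_rep M \<mu>' c xs)"
  proof (intro ballI allI impI)
    fix c and xs :: "(real^3) list"
    assume c: "c \<in> atlas M" and xs: "length xs = 3"
    have "smooth_on (chart_image c) (\<lambda>z. h (chart_inv c z) * form_rep M \<mu> c xs z)"
      using \<mu>_form[unfolded diff_form_def, THEN conjunct2, THEN conjunct2, THEN conjunct2, rule_format, OF c xs]
      by (intro smooth_on_bilinear[OF bounded_bilinear_mult] smooth_h c)
    then show "smooth_on (chart_image c) (form_rep M \<mu>' c xs)"
      by (simp add: form_rep_def[abs_def] \<mu>'_def form_scale_def)
  qed
qed

lemma \<mu>'_volume: "volume_form M \<mu>'"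
  unfolding volume_form_def
proof (intro conjI ballI \<mu>'_form)
  fix p assume p: "p \<in> carrier_of M"
  then obtain vs where "\<mu> p vs \<noteq> 0" using \<mu>_volume by (auto simp: volume_form_def)
  then show "\<exists>vs. \<mu>' p vs \<noteq> 0" using h_pos[OF p] by (auto simp: \<mu>'_def form_scale_def)
qed

section \<open>Divergences and the Lie bracket\<close>

lemma \<nu>_eq_cross:
  assumes c: "c \<in> charts_at M p"
  shows "covec \<nu> c p = vol_density \<mu>' c p *\<^sub>R cross3 (B' p c) (u p c)"
proof (rule vector_eq_ldot[THEN iffD1], rule allI)
  fix x
  have p: "p \<in> carrier_of M" using charts_atD(4)[OF c] .
  have "\<mu> p [B p, u p, tangent_of M p c x] = \<nu> p [tangent_of M p c x]"
    using contraction_eq_iff_ucoord[OF c u_in] u_coord[OF c] tangent_of_in[OF c] by blast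
  then have "vol_density \<mu> c p * (B p c \<bullet> cross3 (u p c) x) = covec \<nu> c p \<bullet> x"
    using three_form_eq[OF \<mu>_form c vf_in[OF B_vf] u_in tangent_of_in[OF c]]
    by (simp add: one_form_tangent_of[OF \<nu>_form c] tangent_of_self[OF c])
  moreover have "B p c \<bullet> cross3 (u p c) x = cross3 (B p c) (u p c) \<bullet> x"
    by (simp add: inner3 cross_components algebra_simps)
  ultimately show "x \<bullet> covec \<nu> c p = x \<bullet> vol_density \<mu>' c p *\<^sub>R cross3 (B' p c) (u p c)"
    using h_pos[OF p] by (simp add: B'_coord vol_density_\<mu>' cross_mult_left inner_commute field_simps)
qed

text \<open>In terms of forms, the next two facts are \<open>\<iota>\<^bsub>B'\<^esub> \<mu>' = \<iota>\<^bsub>B\<^esub> \<mu>\<close> and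
  \<open>\<iota>\<^bsub>u\<^esub> \<mu>' = \<nu> \<and> \<eta>\<close>. They move the divergence of the fields with respect to \<open>\<mu>'\<close> to known objects.\<close>

lemma vol_density_B':
  assumes "c \<in> charts_at M p"
  shows "vol_density \<mu>' c p *\<^sub>R B' p c = vol_density \<mu> c p *\<^sub>R B p c"
  using h_pos[OF charts_atD(4)[OF assms]] by (simp add: B'_coord vol_density_\<mu>')

lemma vol_density_u:
  assumes "c \<in> charts_at M p"
  shows "vol_density \<mu>' c p *\<^sub>R u p c = cross3 (covec \<nu> c p) (covec \<eta> c p)"
proof -
  have "h p * vol_density \<mu> c p * inverse (vol_density \<mu> c p * h p) = 1"
    using h_pos[OF charts_atD(4)[OF assms]] vol_density_nonzero[OF \<mu>_volume assms] by (simp add: field_simps)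
  then show ?thesis
    by (simp add: u_coord[OF assms] ucoord_def vol_density_\<mu>' del: inverse_mult_distrib)
qed

text \<open>If the density of \<open>\<mu>'\<close> times \<open>X\<close> is a known field \<open>W\<close> throughout a chart, then its divergence can be
  read off from the derivative of \<open>W\<close>; no derivative of the factor \<open>h\<close> has to be computed.\<close>

lemma flux_divergence_eq_trace3:
  assumes X: "vector_field M X" and p: "p \<in> carrier_of M" and c: "c = chart_at M p"
    and eq: "\<And>q. c \<in> charts_at M q \<Longrightarrow> vol_density \<mu>' c q *\<^sub>R X q c = W q"
    and W: "((\<lambda>z. W (chart_inv c z)) has_derivative W') (at (snd c p) within half_space)"
  shows "flux_divergence X \<mu>' p = trace3 W'"
proof -
  have ca: "c \<in> charts_at M p" using chart_at_in[OF p] c by simp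
  let ?y = "snd c p"
  have "((\<lambda>z. drep \<mu>' c z *\<^sub>R vf_rep X c z) has_derivative
      (\<lambda>v. drep \<mu>' c ?y *\<^sub>R hderiv (vf_rep X c) ?y v + hderiv (drep \<mu>' c) ?y v *\<^sub>R vf_rep X c ?y))
      (at ?y within half_space)"
    by (rule has_derivative_scaleR[OF vol_density_has_derivative[OF \<mu>'_form ca] vf_has_derivative[OF X ca]])
  moreover have "((\<lambda>z. drep \<mu>' c z *\<^sub>R vf_rep X c z) has_derivative W') (at ?y within half_space)"
  proof (rule has_derivative_half_space_cong[OF openin_chart_image[OF charts_atD(1)[OF ca]]
        coord_in_chart_image[OF ca] _ W])
    show "drep \<mu>' c z *\<^sub>R vf_rep X c z = W (chart_inv c z)" if "z \<in> chart_image c" for z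
      using eq[OF chart_inv_in(1)[OF charts_atD(1)[OF ca] that]] by (simp add: vf_rep_def)
  qed
  ultimately have W'_eq: 
    "(\<lambda>v. drep \<mu>' c ?y *\<^sub>R hderiv (vf_rep X c) ?y v + hderiv (drep \<mu>' c) ?y v *\<^sub>R vf_rep X c ?y) = W'"
    using coord_in_half_space[OF ca] by (rule hderiv_unique)
  have "linear (hderiv (drep \<mu>' c) ?y)"
    using vol_density_has_derivative[OF \<mu>'_form ca] has_derivative_linear by blast
  then have "trace3 W' = hderiv (drep \<mu>' c) ?y (vf_rep X c ?y)
      + drep \<mu>' c ?y * trace3 (hderiv (vf_rep X c) ?y)"
    unfolding W'_eq[symmetric] by (rule trace3_scaled)
  then show ?thesis
    by (simp add: flux_divergence_def c[symmetric] Let_def vf_rep_coord[OF ca] chart_inv_coord[OF ca])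
qed

lemma lie_deriv_B': "lie_deriv M B' \<mu>' = form_zero"
  unfolding lie_deriv_volume_eq_zero_iff[OF \<mu>'_form B'_vf]
proof
  fix p assume p: "p \<in> carrier_of M"
  let ?c = "chart_at M p" and ?y = "snd (chart_at M p) p"
  note ca = chart_at_in[OF p]
  let ?W = "\<lambda>v. drep \<mu> ?c ?y *\<^sub>R hderiv (vf_rep B ?c) ?y v + hderiv (drep \<mu> ?c) ?y v *\<^sub>R vf_rep B ?c ?y"
  have "flux_divergence B' \<mu>' p = trace3 ?W"
  proof (rule flux_divergence_eq_trace3[OF B'_vf p refl])
    show "vol_density \<mu>' ?c q *\<^sub>R B' q ?c = vol_density \<mu> ?c q *\<^sub>R B q ?c" if "?c \<in> charts_at M q" for q
      using vol_density_B'[OF that] .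
    show "((\<lambda>z. drep \<mu> ?c z *\<^sub>R B (chart_inv ?c z) ?c) has_derivative ?W) (at ?y within half_space)"
      using has_derivative_scaleR[OF vol_density_has_derivative[OF \<mu>_form ca] vf_has_derivative[OF B_vf ca]]
      unfolding vf_rep_def .
  qed
  also have "\<dots> = hderiv (drep \<mu> ?c) ?y (vf_rep B ?c ?y) + drep \<mu> ?c ?y * trace3 (hderiv (vf_rep B ?c) ?y)"
    by (rule trace3_scaled) (use vol_density_has_derivative[OF \<mu>_form ca] has_derivative_linear in blast)
  also have "\<dots> = flux_divergence B \<mu> p"
    by (simp add: flux_divergence_def Let_def vf_rep_coord[OF ca] chart_inv_coord[OF ca])
  also have "\<dots> = 0"
    using B_\<mu> p unfolding lie_deriv_volume_eq_zero_iff[OF \<mu>_form B_vf] by blast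
  finally show "flux_divergence B' \<mu>' p = 0" .
qed

text \<open>In coordinates, a closed 1-form has a symmetric derivative.\<close>

lemma \<nu>_derivative_symmetric:
  assumes p: "p \<in> carrier_of M" and c: "c = chart_at M p"
  shows "hderiv (crep \<nu> c) (snd c p) x \<bullet> y = hderiv (crep \<nu> c) (snd c p) y \<bullet> x"
proof -
  have ca: "c \<in> charts_at M p" using chart_at_in[OF p] c by simp
  show ?thesis
    using ext_deriv_one_form[OF \<nu>_form p tangent_of_in[OF ca] tangent_of_in[OF ca] c, of x y]
    by (simp add: \<nu>_closed form_zero_def tangent_of_self[OF ca])
qed

lemma lie_deriv_u: "lie_deriv M u \<mu>' = form_zero"
  unfolding lie_deriv_volume_eq_zero_iff[OF \<mu>'_form u_vf]
proof
  fix p assume p: "p \<in> carrier_of M"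
  let ?c = "chart_at M p" and ?y = "snd (chart_at M p) p"
  note ca = chart_at_in[OF p]
  let ?N = "hderiv (crep \<nu> ?c) ?y" and ?E = "hderiv (crep \<eta> ?c) ?y"
  let ?n = "covec \<nu> ?c p"
  let ?W = "\<lambda>v. cross3 ?n (?E v) + cross3 (?N v) (covec \<eta> ?c p)"
  have "flux_divergence u \<mu>' p = trace3 ?W"
  proof (rule flux_divergence_eq_trace3[OF u_vf p refl])
    show "vol_density \<mu>' ?c q *\<^sub>R u q ?c = cross3 (covec \<nu> ?c q) (covec \<eta> ?c q)" if "?c \<in> charts_at M q" for q
      using vol_density_u[OF that] .
    show "((\<lambda>z. cross3 (crep \<nu> ?c z) (crep \<eta> ?c z)) has_derivative ?W) (at ?y within half_space)"
      using bounded_bilinear.FDERIV[OF bounded_bilinear_cross3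
          covec_has_derivative[OF \<nu>_form ca] covec_has_derivative[OF \<eta>_form ca]]
      by (simp add: chart_inv_coord[OF ca])
  qed
  also have "\<dots> = 0"
  proof (rule trace3_cross)
    show "?N v \<bullet> w = ?N w \<bullet> v" for v w using \<nu>_derivative_symmetric[OF p refl] .
    let ?T = "\<lambda>i. tangent_of M p ?c (e3 i)"
    have d: "ext_deriv M \<eta> p [?T i, ?T j] = ?E (e3 i) $ j - ?E (e3 j) $ i" for i j
      using ext_deriv_one_form[OF \<eta>_form p tangent_of_in[OF ca] tangent_of_in[OF ca] refl, of "e3 i" "e3 j"]
      by (simp add: tangent_of_self[OF ca] inner_axis)
    have n: "\<nu> p [?T i] = ?n $ i" for i
      by (simp add: covec_def)
    have "wedge 2 1 (ext_deriv M \<eta>) \<nu> p [?T 1, ?T 2, ?T 3] = 0"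
      by (simp only: d\<eta>_\<nu> form_zero_def)
    then show "?n $ 1 * (?E (e3 2) $ 3 - ?E (e3 3) $ 2) + ?n $ 2 * (?E (e3 3) $ 1 - ?E (e3 1) $ 3)
            + ?n $ 3 * (?E (e3 1) $ 2 - ?E (e3 2) $ 1) = 0"
      unfolding wedge_2_1 d n by (simp add: algebra_simps)
  qed
  finally show "flux_divergence u \<mu>' p = 0" .
qed

text \<open>The relation \<open>\<nu> = m (B' \<times> u)\<close>, with \<open>m\<close> the density of \<open>\<mu>'\<close>, holds in the whole chart and can
  therefore be differentiated; the rest is the identity for the curl of a cross product.\<close>

lemma bracket_zero: "lie_bracket M u B' = vf_zero"
proof
  fix p
  let ?c = "chart_at M p"
  show "lie_bracket M u B' p = vf_zero p"
  proof (cases "p \<in> carrier_of M")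
    case False
    then have "charts_at M p = {}" using charts_atD(4) by blast
    then show ?thesis by (simp add: lie_bracket_def Let_def tangent_of_def vf_zero_def)
  next
    case p: True
    let ?y = "snd ?c p"
    note ca = chart_at_in[OF p]
    note dX = vf_has_derivative[OF u_vf ca] and dY = vf_has_derivative[OF B'_vf ca]
      and dm = vol_density_has_derivative[OF \<mu>'_form ca]
    have div: "flux_divergence u \<mu>' p = 0" "flux_divergence B' \<mu>' p = 0"
      using lie_deriv_u lie_deriv_B' p
      unfolding lie_deriv_volume_eq_zero_iff[OF \<mu>'_form u_vf] lie_deriv_volume_eq_zero_iff[OF \<mu>'_form B'_vf]
      by blast+
    have "hderiv (vf_rep B' ?c) ?y (u p ?c) - hderiv (vf_rep u ?c) ?y (B' p ?c) = 0"
    proof (rule bracket_eq_zero[where m = "vol_density \<mu>' ?c p" and M' = "hderiv (drep \<mu>' ?c) ?y"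
          and N = "hderiv (crep \<nu> ?c) ?y" and X' = "hderiv (vf_rep u ?c) ?y"
          and Y' = "hderiv (vf_rep B' ?c) ?y"])
      show "vol_density \<mu>' ?c p \<noteq> 0" by (rule vol_density_nonzero[OF \<mu>'_volume ca])
      show "linear (hderiv (vf_rep u ?c) ?y)" "linear (hderiv (vf_rep B' ?c) ?y)"
        "linear (hderiv (drep \<mu>' ?c) ?y)"
        using dX dY dm has_derivative_linear by blast+
      show "hderiv (crep \<nu> ?c) ?y v \<bullet> w = hderiv (crep \<nu> ?c) ?y w \<bullet> v" for v w
        using \<nu>_derivative_symmetric[OF p refl] .
      have "hderiv (crep \<nu> ?c) ?y = (\<lambda>v. drep \<mu>' ?c ?y *\<^sub>R
            (cross3 (vf_rep B' ?c ?y) (hderiv (vf_rep u ?c) ?y v) + cross3 (hderiv (vf_rep B' ?c) ?y v) (vf_rep u ?c ?y))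
          + hderiv (drep \<mu>' ?c) ?y v *\<^sub>R cross3 (vf_rep B' ?c ?y) (vf_rep u ?c ?y))"
      proof (rule hderiv_chart_eq[OF ca _ has_derivative_scaleR[OF dm
              bounded_bilinear.FDERIV[OF bounded_bilinear_cross3 dY dX]]])
        show "crep \<nu> ?c z = drep \<mu>' ?c z *\<^sub>R cross3 (vf_rep B' ?c z) (vf_rep u ?c z)"
          if "z \<in> chart_image ?c" for z
          using \<nu>_eq_cross[OF chart_inv_in(1)[OF charts_atD(1)[OF ca] that]] by (simp add: vf_rep_def)
      qed
      then show "hderiv (crep \<nu> ?c) ?y v = vol_density \<mu>' ?c p *\<^sub>R
            (cross3 (B' p ?c) (hderiv (vf_rep u ?c) ?y v) + cross3 (hderiv (vf_rep B' ?c) ?y v) (u p ?c))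
          + hderiv (drep \<mu>' ?c) ?y v *\<^sub>R cross3 (B' p ?c) (u p ?c)" for v
        by (simp add: vf_rep_coord[OF ca] chart_inv_coord[OF ca])
      show "hderiv (drep \<mu>' ?c) ?y (u p ?c) + vol_density \<mu>' ?c p * trace3 (hderiv (vf_rep u ?c) ?y) = 0"
        "hderiv (drep \<mu>' ?c) ?y (B' p ?c) + vol_density \<mu>' ?c p * trace3 (hderiv (vf_rep B' ?c) ?y) = 0"
        using div by (simp_all add: flux_divergence_def Let_def)
    qed
    then show ?thesis
      by (simp add: lie_bracket_def Let_def vf_rep_coord[OF ca] tangent_of_zero[OF ca] vf_zero_def)
  qed
qed

lemma \<nu>_u: "pairing \<nu> u = (\<lambda>p. 0)"
proof
  fix p
  show "pairing \<nu> u p = 0"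
  proof (cases "p \<in> carrier_of M")
    case True
    then show ?thesis
      by (simp add: pairing_coord[OF \<nu>_form u_in chart_at_in] u_coord[OF chart_at_in] ucoord_def dot_cross_self)
  qed (rule pairing_outside[OF \<nu>_form])
qed

lemma \<nu>_B': "pairing \<nu> B' = (\<lambda>p. 0)"
proof
  fix p
  show "pairing \<nu> B' p = 0"
  proof (cases "p \<in> carrier_of M")
    case True
    then show ?thesis
      by (simp add: pairing_coord[OF \<nu>_form B'_in chart_at_in] B'_coord \<nu>_B_coord chart_at_in)
  qed (rule pairing_outside[OF \<nu>_form])
qed

text \<open>A linear relation between \<open>u\<close> and \<open>B'\<close> would make \<open>B' \<times> u\<close>, hence \<open>\<nu>\<close>, vanish.\<close>

lemma u_B'_independent:
  assumes p: "p \<in> carrier_of M" and v: "v \<in> tangent_space M p" "\<nu> p [v] \<noteq> 0"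
  shows "lin_indep2 (u p) (B' p)"
  unfolding lin_indep2_def
proof (intro allI impI)
  fix a b
  assume "tlin a (u p) b (B' p) = (\<lambda>_. 0)"
  note ca = chart_at_in[OF p]
  let ?c = "chart_at M p"
  let ?X = "u p ?c" and ?Y = "B' p ?c"
  have ab: "a *\<^sub>R ?X + b *\<^sub>R ?Y = 0"
    using fun_cong[OF \<open>tlin a (u p) b (B' p) = (\<lambda>_. 0)\<close>, of ?c] by (simp add: tlin_def)
  have "covec \<nu> ?c p \<noteq> 0" using v one_form_eq[OF \<nu>_form ca v(1)] by auto
  then have ne: "cross3 ?Y ?X \<noteq> 0" using \<nu>_eq_cross[OF ca] by auto
  have "a *\<^sub>R cross3 ?Y ?X = cross3 ?Y (a *\<^sub>R ?X + b *\<^sub>R ?Y)"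
    by (simp add: cross_add_right cross_mult_right)
  moreover have "b *\<^sub>R cross3 ?Y ?X = cross3 (a *\<^sub>R ?X + b *\<^sub>R ?Y) ?X"
    by (simp add: cross_add_left cross_mult_left)
  ultimately have "a *\<^sub>R cross3 ?Y ?X = 0" "b *\<^sub>R cross3 ?Y ?X = 0"
    unfolding ab by simp_all
  then show "a = 0 \<and> b = 0" using ne by simp
qed

end

theorem theoremI3:
  fixes M :: "'a manifold3" and B :: "'a vfield" and \<nu> \<mu> \<eta> :: "'a form"
  assumes "smooth_manifold3 M"
    and "flux_system M B \<nu> \<mu>"
    and "adapted M B \<nu> \<mu> \<eta>"
  shows "\<exists>u.
    (vector_field M u \<and>
     interior_product u \<mu> = form_scale (\<lambda>p. 1 / pairing \<eta> B p) (wedge 1 1 \<nu> \<eta>) \<and>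
     (\<forall>w. vector_field M w \<and>
          interior_product w \<mu> = form_scale (\<lambda>p. 1 / pairing \<eta> B p) (wedge 1 1 \<nu> \<eta>)
          \<longrightarrow> w = u)) \<and>
    (interior_product u (interior_product B \<mu>) = \<nu> \<and> pairing \<eta> u = (\<lambda>p. 0) \<and>
     (\<forall>w. vector_field M w \<and>
          interior_product w (interior_product B \<mu>) = \<nu> \<and> pairing \<eta> w = (\<lambda>p. 0)
          \<longrightarrow> w = u)) \<and>
    (let B' = vf_scale (\<lambda>p. 1 / pairing \<eta> B p) B;
         \<mu>' = form_scale (pairing \<eta> B) \<mu>
     in vector_field M B' \<and> volume_form M \<mu>' \<and>
        (\<forall>p\<in>carrier_of M. (\<exists>v\<in>tangent_space M p. \<nu> p [v] \<noteq> 0) \<longrightarrow> lin_indep2 (u p) (B' p)) \<and>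
        pairing \<nu> B' = (\<lambda>p. 0) \<and> pairing \<nu> u = (\<lambda>p. 0) \<and>
        lie_bracket M u B' = vf_zero \<and>
        lie_deriv M u \<mu>' = form_zero \<and> lie_deriv M B' \<mu>' = form_zero)"
proof -
  interpret adapted_flux M B \<nu> \<mu> \<eta>
    using assms by unfold_locales
  show ?thesis
    unfolding Let_def B'_def[symmetric] \<mu>'_def[symmetric]
    using u_vf interior_product_eq_iff contraction_eq_iff B'_vf \<mu>'_volume u_B'_independent
      \<nu>_B' \<nu>_u bracket_zero lie_deriv_u lie_deriv_B'
    by (intro exI[of _ u]) blast
qed

end
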